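(* Let $V=\mathbb{C}[G]\otimes\mathbb{C}[x_1,x_2,\dots]$, where $G$ is the free abelian group with basis $\alpha_1,\dots,\alpha_k$, with the Hopf structure in which the $e^{\alpha}$ ($\alpha\in G$) are grouplike and the $x_m$ are primitive. Let $A$ be a commutative $\mathbb{C}$-algebra and $r$ an $A$-valued bicharacter on $V$ taking complex values on grouplike elements, with $r(e^{\alpha_i}\otimes e^{\alpha_j})=e^{a_{ij}}$ ($a_{ij}\in\mathbb{C}$), $r(e^{\alpha_i}\otimes x_m)=b_{im}$, $r(x_m\otimes e^{\alpha_i})=c_{mi}$, $r(x_m\otimes x_n)=q_{mn}$. Let $s=r\circ r^t$ be its symmetrization and $\bullet=\bullet_s$. Let \[ \mathbf{Q}=\sum_{i,j=1}^{k}a_{ij}\frac{\partial}{\partial\alpha_i}\frac{\partial}{\partial\alpha_j}+\sum_{i=1}^{k}\sum_{m\ge1}b_{im}\frac{\partial}{\partial\alpha_i}\frac{\partial}{\partial x_m}+\sum_{m\ge1}\sum_{i=1}^{k}c_{mi}\frac{\partial}{\partial x_m}\frac{\partial}{\partial\alpha_i}+\sum_{m,n\ge1}q_{mn}\frac{\partial^2}{\partial x_m\partial x_n}. \] Then for every $a\in V$, \[ e^{\mathbf{Q}}(a)=\mathrm{EQ}_r(a)=\sum r(a'\otimes a'')a''', \] moreover $e^{\mathbf{Q}}(a)=a^{\bullet}$, and $e^{\mathbf{Q}}$ is a homomorphism from $(V\otimes A,\cdot)$ to $(V\otimes A,\bullet)$.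
   Context: Hopf structure: $\Delta(e^{\alpha})=e^\alpha\otimes e^\alpha$, $\eta(e^\alpha)=1$; $\Delta(x_m)=x_m\otimes1+1\otimes x_m$, $\eta(x_m)=0$. Sweedler notation: $\Delta(a)=\sum a'\otimes a''$, $\Delta^2(a)=\sum a'\otimes a''\otimes a'''$. An $A$-valued bicharacter is a linear map $r:V\otimes V\to A$ with $r(1\otimes a)=\eta(a)=r(a\otimes1)$, $r(ab\otimes c)=\sum r(a\otimes c')r(b\otimes c'')$, $r(a\otimes bc)=\sum r(a'\otimes b)r(a''\otimes c)$. Convolution $(r\circ t)(a\otimes b)=\sum r(a'\otimes b')t(a''\otimes b'')$, $r^t(a\otimes b)=r(b\otimes a)$. The product $\bullet_s$ on $V\otimes A$ is the $A$-bilinear extension of $a\bullet_s b=\sum a'b'\,s(a''\otimes b'')$ (associative, commutative). Derivations: $\frac{\partial}{\partial\alpha_i}(e^{\alpha}P(x))=m_ie^\alpha P(x)$ for $\alpha=\sum m_j\alpha_j$; $\frac{\partial}{\partial x_m}$ acts on the polynomial factor. $e^{\mathbf{Q}}$ is the product of the commuting exponentials of the four summands, the first acting on $e^\alpha P$ as multiplication by $\exp(\sum a_{ij}m_im_j)$, the others as locally finite power series. For $P\in\mathbb{C}[x_1,x_2,\dots]$, $P^\bullet$ is obtained by replacing each monomial $x_{i_1}\cdots x_{i_n}$ in $P$ by $x_{i_1}\bullet\cdots\bullet x_{i_n}$. For $a=e^{\alpha}P$ one sets $a^\bullet=(e^\alpha)^\bullet\bullet P^\bullet$ with $(e^\alpha)^\bullet=e^{\alpha}r(e^\alpha\otimes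 e^\alpha)$, extended linearly to all of $V$. *)

theory Defs
  imports Complex_Main "HOL-Library.Poly_Mapping" "HOL-Library.Function_Algebras"
    "HOL-Library.Product_Plus"
begin

text \<open>Basis of V = C[G] (x) C[x_0,x_1,...]: pairs (alpha, mu) with alpha in G = Z^k
  (functions from the finite index type 'k to int) and mu a monomial
  (finitely supported exponent vector).  Elements of V are finitely supported
  complex-valued functions on the basis, elements of V (x) A finitely supported
  A-valued functions; the algebra product is the monoid-algebra product.\<close>

type_synonym 'k bas = "('k \<Rightarrow> int) \<times> (nat \<Rightarrow>\<^sub>0 nat)"

definition bv :: "'b \<Rightarrow> ('b \<Rightarrow>\<^sub>0 'a::{zero,one})" where
  "bv u = Poly_Mapping.single u 1"

definition smul :: "'a::semiring_0 \<Rightarrow> ('b \<Rightarrow>\<^sub>0 'a) \<Rightarrow> ('b \<Rightarrow>\<^sub>0 'a)" where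
  "smul s f = Poly_Mapping.map (\<lambda>x. s * x) f"

definition lin_ext :: "('b \<Rightarrow> ('c \<Rightarrow>\<^sub>0 'a::semiring_0)) \<Rightarrow> ('b \<Rightarrow>\<^sub>0 'a) \<Rightarrow> ('c \<Rightarrow>\<^sub>0 'a)" where
  "lin_ext T f = (\<Sum>u\<in>Poly_Mapping.keys f. smul (Poly_Mapping.lookup f u) (T u))"

definition C_algebra_hom :: "(complex \<Rightarrow> 'a::comm_ring_1) \<Rightarrow> bool" where
  "C_algebra_hom \<iota> \<longleftrightarrow> \<iota> 1 = 1 \<and> (\<forall>x y. \<iota> (x + y) = \<iota> x + \<iota> y) \<and> (\<forall>x y. \<iota> (x * y) = \<iota> x * \<iota> y)"

definition embA :: "(complex \<Rightarrow> 'a::comm_ring_1) \<Rightarrow> ('b \<Rightarrow>\<^sub>0 complex) \<Rightarrow> ('b \<Rightarrow>\<^sub>0 'a)" where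
  "embA \<iota> v = Poly_Mapping.map \<iota> v"

definition alpha_gen :: "'k \<Rightarrow> ('k \<Rightarrow> int)" where
  "alpha_gen i = (\<lambda>j. if j = i then 1 else 0)"

definition xvar :: "nat \<Rightarrow> ('k bas \<Rightarrow>\<^sub>0 'a::comm_ring_1)" where
  "xvar m = bv (0, Poly_Mapping.single m 1)"

definition d_alpha :: "'k \<Rightarrow> ('k bas \<Rightarrow>\<^sub>0 'a::comm_ring_1) \<Rightarrow> ('k bas \<Rightarrow>\<^sub>0 'a)" where
  "d_alpha i = lin_ext (\<lambda>(\<alpha>, \<mu>). Poly_Mapping.single (\<alpha>, \<mu>) (of_int (\<alpha> i)))"

definition d_x :: "nat \<Rightarrow> ('k bas \<Rightarrow>\<^sub>0 'a::comm_ring_1) \<Rightarrow> ('k bas \<Rightarrow>\<^sub>0 'a)" where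
  "d_x m = lin_ext (\<lambda>(\<alpha>, \<mu>). if Poly_Mapping.lookup \<mu> m = 0 then 0
      else Poly_Mapping.single (\<alpha>, \<mu> - Poly_Mapping.single m 1) (of_nat (Poly_Mapping.lookup \<mu> m)))"

text \<open>The second, third and fourth summands of Q (the infinite sums over m, n have
  only finitely many nonzero terms on each basis element, namely m, n among the
  variables occurring in the monomial).\<close>
definition Q_b :: "('k::finite \<Rightarrow> nat \<Rightarrow> 'a) \<Rightarrow> ('k bas \<Rightarrow>\<^sub>0 'a::comm_ring_1) \<Rightarrow> ('k bas \<Rightarrow>\<^sub>0 'a)" where
  "Q_b b = lin_ext (\<lambda>(\<alpha>, \<mu>). \<Sum>i\<in>UNIV. \<Sum>m\<in>Poly_Mapping.keys \<mu>.
       smul (b i m) (d_alpha i (d_x m (bv (\<alpha>, \<mu>)))))"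

definition Q_c :: "(nat \<Rightarrow> 'k::finite \<Rightarrow> 'a) \<Rightarrow> ('k bas \<Rightarrow>\<^sub>0 'a::comm_ring_1) \<Rightarrow> ('k bas \<Rightarrow>\<^sub>0 'a)" where
  "Q_c c = lin_ext (\<lambda>(\<alpha>, \<mu>). \<Sum>m\<in>Poly_Mapping.keys \<mu>. \<Sum>i\<in>UNIV.
       smul (c m i) (d_x m (d_alpha i (bv (\<alpha>, \<mu>)))))"

definition Q_q :: "(nat \<Rightarrow> nat \<Rightarrow> 'a) \<Rightarrow> ('k bas \<Rightarrow>\<^sub>0 'a::comm_ring_1) \<Rightarrow> ('k bas \<Rightarrow>\<^sub>0 'a)" where
  "Q_q q = lin_ext (\<lambda>(\<alpha>, \<mu>). \<Sum>m\<in>Poly_Mapping.keys \<mu>. \<Sum>n\<in>Poly_Mapping.keys \<mu>.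
       smul (q m n) (d_x m (d_x n (bv (\<alpha>, \<mu>)))))"

definition xdeg :: "('k bas \<Rightarrow>\<^sub>0 'a::zero) \<Rightarrow> nat" where
  "xdeg f = Max (insert 0 ((\<lambda>u. \<Sum>m\<in>Poly_Mapping.keys (snd u). Poly_Mapping.lookup (snd u) m) ` Poly_Mapping.keys f))"

text \<open>Exponential of a degree-lowering operator as a locally finite power series
  (T^n f = 0 for n > xdeg f, so the truncation is the full series).\<close>
definition expop :: "(complex \<Rightarrow> 'a::comm_ring_1) \<Rightarrow> (('k bas \<Rightarrow>\<^sub>0 'a) \<Rightarrow> ('k bas \<Rightarrow>\<^sub>0 'a))
    \<Rightarrow> ('k bas \<Rightarrow>\<^sub>0 'a) \<Rightarrow> ('k bas \<Rightarrow>\<^sub>0 'a)" where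
  "expop \<iota> T f = (\<Sum>n\<le>xdeg f. smul (\<iota> (1 / of_nat (fact n))) ((T ^^ n) f))"

definition exp_Qa :: "(complex \<Rightarrow> 'a::comm_ring_1) \<Rightarrow> ('k::finite \<Rightarrow> 'k \<Rightarrow> complex)
    \<Rightarrow> ('k bas \<Rightarrow>\<^sub>0 'a) \<Rightarrow> ('k bas \<Rightarrow>\<^sub>0 'a)" where
  "exp_Qa \<iota> a = lin_ext (\<lambda>(\<alpha>, \<mu>). Poly_Mapping.single (\<alpha>, \<mu>)
      (\<iota> (exp (\<Sum>i\<in>UNIV. \<Sum>j\<in>UNIV. a i j * of_int (\<alpha> i) * of_int (\<alpha> j)))))"

definition expQ :: "(complex \<Rightarrow> 'a::comm_ring_1) \<Rightarrow> ('k::finite \<Rightarrow> 'k \<Rightarrow> complex)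
    \<Rightarrow> ('k \<Rightarrow> nat \<Rightarrow> 'a) \<Rightarrow> (nat \<Rightarrow> 'k \<Rightarrow> 'a) \<Rightarrow> (nat \<Rightarrow> nat \<Rightarrow> 'a)
    \<Rightarrow> ('k bas \<Rightarrow>\<^sub>0 'a) \<Rightarrow> ('k bas \<Rightarrow>\<^sub>0 'a)" where
  "expQ \<iota> a b c q f = exp_Qa \<iota> a (expop \<iota> (Q_b b) (expop \<iota> (Q_c c) (expop \<iota> (Q_q q) f)))"

definition divs :: "(nat \<Rightarrow>\<^sub>0 nat) \<Rightarrow> (nat \<Rightarrow>\<^sub>0 nat) set" where
  "divs \<mu> = {\<nu>. \<forall>m. Poly_Mapping.lookup \<nu> m \<le> Poly_Mapping.lookup \<mu> m}"

definition mbinom :: "(nat \<Rightarrow>\<^sub>0 nat) \<Rightarrow> (nat \<Rightarrow>\<^sub>0 nat) \<Rightarrow> nat" where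
  "mbinom \<mu> \<nu> = (\<Prod>m\<in>Poly_Mapping.keys \<mu>. Poly_Mapping.lookup \<mu> m choose Poly_Mapping.lookup \<nu> m)"

text \<open>Coproduct of a basis element e^alpha x^mu (e^alpha grouplike, x_m primitive).\<close>
definition Delta_b :: "'k bas \<Rightarrow> ('k bas \<times> 'k bas \<Rightarrow>\<^sub>0 complex)" where
  "Delta_b u = (case u of (\<alpha>, \<mu>) \<Rightarrow>
     \<Sum>\<nu>\<in>divs \<mu>. Poly_Mapping.single ((\<alpha>, \<nu>), (\<alpha>, \<mu> - \<nu>)) (of_nat (mbinom \<mu> \<nu>)))"

definition Delta :: "('k bas \<Rightarrow>\<^sub>0 complex) \<Rightarrow> ('k bas \<times> 'k bas \<Rightarrow>\<^sub>0 complex)" where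
  "Delta v = lin_ext Delta_b v"

definition eta :: "('k bas \<Rightarrow>\<^sub>0 complex) \<Rightarrow> complex" where
  "eta v = (\<Sum>u\<in>Poly_Mapping.keys v. Poly_Mapping.lookup v u * (if snd u = 0 then 1 else 0))"

text \<open>A C-linear map r : V (x) V \<rightarrow> A is given by its values r u v on pairs of basis
  elements; rV is its bilinear extension.\<close>
definition rV :: "(complex \<Rightarrow> 'a::comm_ring_1) \<Rightarrow> ('k bas \<Rightarrow> 'k bas \<Rightarrow> 'a)
    \<Rightarrow> ('k bas \<Rightarrow>\<^sub>0 complex) \<Rightarrow> ('k bas \<Rightarrow>\<^sub>0 complex) \<Rightarrow> 'a" where
  "rV \<iota> r v w = (\<Sum>u\<in>Poly_Mapping.keys v. \<Sum>u'\<in>Poly_Mapping.keys w. \<iota> (Poly_Mapping.lookup v u * Poly_Mapping.lookup w u') * r u u')"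

definition bicharacter :: "(complex \<Rightarrow> 'a::comm_ring_1) \<Rightarrow> ('k bas \<Rightarrow> 'k bas \<Rightarrow> 'a) \<Rightarrow> bool" where
  "bicharacter \<iota> r \<longleftrightarrow>
     (\<forall>v. rV \<iota> r 1 v = \<iota> (eta v)) \<and> (\<forall>v. rV \<iota> r v 1 = \<iota> (eta v)) \<and>
     (\<forall>v w z. rV \<iota> r (v * w) z =
        (\<Sum>p\<in>Poly_Mapping.keys (Delta z). \<iota> (Poly_Mapping.lookup (Delta z) p) * rV \<iota> r v (bv (fst p)) * rV \<iota> r w (bv (snd p)))) \<and>
     (\<forall>v w z. rV \<iota> r v (w * z) =
        (\<Sum>p\<in>Poly_Mapping.keys (Delta v). \<iota> (Poly_Mapping.lookup (Delta v) p) * rV \<iota> r (bv (fst p)) w * rV \<iota> r (bv (snd p)) z))"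

text \<open>EQ_r(a) = sum r(a' (x) a'') a''', using Delta^2 = (Delta (x) id) Delta.\<close>
definition EQr :: "(complex \<Rightarrow> 'a::comm_ring_1) \<Rightarrow> ('k bas \<Rightarrow> 'k bas \<Rightarrow> 'a)
    \<Rightarrow> ('k bas \<Rightarrow>\<^sub>0 complex) \<Rightarrow> ('k bas \<Rightarrow>\<^sub>0 'a)" where
  "EQr \<iota> r v = (\<Sum>u\<in>Poly_Mapping.keys v. smul (\<iota> (Poly_Mapping.lookup v u))
      (\<Sum>p\<in>Poly_Mapping.keys (Delta_b u). \<Sum>p'\<in>Poly_Mapping.keys (Delta_b (fst p)).
         smul (\<iota> (Poly_Mapping.lookup (Delta_b u) p * Poly_Mapping.lookup (Delta_b (fst p)) p') * r (fst p') (snd p'))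
              (bv (snd p))))"

definition s_sym :: "(complex \<Rightarrow> 'a::comm_ring_1) \<Rightarrow> ('k bas \<Rightarrow> 'k bas \<Rightarrow> 'a) \<Rightarrow> 'k bas \<Rightarrow> 'k bas \<Rightarrow> 'a" where
  "s_sym \<iota> r u v = (\<Sum>p\<in>Poly_Mapping.keys (Delta_b u). \<Sum>p'\<in>Poly_Mapping.keys (Delta_b v).
      \<iota> (Poly_Mapping.lookup (Delta_b u) p * Poly_Mapping.lookup (Delta_b v) p') * r (fst p) (fst p') * r (snd p') (snd p))"

definition bullet :: "(complex \<Rightarrow> 'a::comm_ring_1) \<Rightarrow> ('k bas \<Rightarrow> 'k bas \<Rightarrow> 'a)
    \<Rightarrow> ('k bas \<Rightarrow>\<^sub>0 'a) \<Rightarrow> ('k bas \<Rightarrow>\<^sub>0 'a) \<Rightarrow> ('k bas \<Rightarrow>\<^sub>0 'a)" where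
  "bullet \<iota> r f g = (\<Sum>u\<in>Poly_Mapping.keys f. \<Sum>v\<in>Poly_Mapping.keys g. smul (Poly_Mapping.lookup f u * Poly_Mapping.lookup g v)
      (\<Sum>p\<in>Poly_Mapping.keys (Delta_b u). \<Sum>p'\<in>Poly_Mapping.keys (Delta_b v).
         smul (\<iota> (Poly_Mapping.lookup (Delta_b u) p * Poly_Mapping.lookup (Delta_b v) p') * s_sym \<iota> r (snd p) (snd p'))
              (bv (fst p + fst p'))))"

definition varlist :: "(nat \<Rightarrow>\<^sub>0 nat) \<Rightarrow> nat list" where
  "varlist \<mu> = concat (map (\<lambda>m. replicate (Poly_Mapping.lookup \<mu> m) m) (sorted_list_of_set (Poly_Mapping.keys \<mu>)))"

fun bprod :: "(complex \<Rightarrow> 'a::comm_ring_1) \<Rightarrow> ('k bas \<Rightarrow> 'k bas \<Rightarrow> 'a) \<Rightarrow> nat list \<Rightarrow> ('k bas \<Rightarrow>\<^sub>0 'a)" where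
  "bprod \<iota> r [] = 1"
| "bprod \<iota> r [m] = xvar m"
| "bprod \<iota> r (m # ms) = bullet \<iota> r (xvar m) (bprod \<iota> r ms)"

text \<open>(e^alpha x^mu)^bullet = (e^alpha)^bullet bullet (x^mu)^bullet with
  (e^alpha)^bullet = e^alpha r(e^alpha (x) e^alpha); extended linearly.\<close>
definition dot :: "(complex \<Rightarrow> 'a::comm_ring_1) \<Rightarrow> ('k bas \<Rightarrow> 'k bas \<Rightarrow> 'a)
    \<Rightarrow> ('k bas \<Rightarrow>\<^sub>0 complex) \<Rightarrow> ('k bas \<Rightarrow>\<^sub>0 'a)" where
  "dot \<iota> r v = (\<Sum>u\<in>Poly_Mapping.keys v. smul (\<iota> (Poly_Mapping.lookup v u))
      (bullet \<iota> r (Poly_Mapping.single (fst u, 0) (r (fst u, 0) (fst u, 0)))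
                  (bprod \<iota> r (varlist (snd u)))))"

end

theory Submission
  imports Defs
begin

text \<open>All operators involved have the form \<open>a \<mapsto> \<Sum> d(a') a''\<close> for a functional \<open>d\<close> on \<open>V\<close>, and
  such operators compose by convolution of the functionals, so they commute. Both \<open>EQ\<^sub>r\<close>
  (with \<open>R(a) = \<Sum> r(a' \<otimes> a'')\<close>) and \<open>e\<^bsup>Q\<^esup>\<close> are of this form. The bicharacter axioms give
  \<open>R(ab) = \<Sum> R(a') R(b') s(a'' \<otimes> b'')\<close>, which is the homomorphism property of \<open>EQ\<^sub>r\<close> and, for
  \<open>b = x\<^sub>m\<close>, the differential equation \<open>R(a x\<^sub>m) = \<Sum> s(a' \<otimes> x\<^sub>m) R(a'')\<close>. The functional of \<open>e\<^bsup>Q\<^esup>\<close>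
  satisfies the same equation and agrees with \<open>R\<close> on grouplike elements, hence equals \<open>R\<close>.\<close>

subsection \<open>Monomials\<close>

text \<open>The obstacle is that Q has order two: the functional of e^Q is in general not
  multiplicative, so it cannot be compared with R on generators alone. Differentiating removes one
  order. Since x_m is primitive, F \<mapsto> F(. x_m) is a derivation of the convolution algebra, so
  exp(d) has logarithmic derivative d(. x_m); for the functional d of a mixed or quadratic summand
  of Q this is linear in the functionals of the derivations. On the other side s(. \<otimes> x_m) =
  r(. \<otimes> x_m) + r(x_m \<otimes> .) is a primitive functional, hence fixed by its values on
  the group generators and on the x_n, that is by b, c and q. The two sides then agree coefficient
  by coefficient, q_mn + q_nm arising on both. The equation gives F(u x_m) from values of F in
  degrees at most that of u, so it determines F from its values on grouplike elements, and there
  only the a_ij enter.\<close>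

abbreviation mdeg :: "(nat \<Rightarrow>\<^sub>0 nat) \<Rightarrow> nat" where
  "mdeg \<mu> \<equiv> \<Sum>m\<in>Poly_Mapping.keys \<mu>. Poly_Mapping.lookup \<mu> m"

lemma keys_add_single_1:
  fixes \<mu> :: "nat \<Rightarrow>\<^sub>0 nat"
  shows "Poly_Mapping.keys (\<mu> + Poly_Mapping.single m 1) = insert m (Poly_Mapping.keys \<mu>)"
  by (auto simp: in_keys_iff lookup_add lookup_single when_def split: if_splits)

lemma mdeg_eq_sum:
  assumes "finite S" "Poly_Mapping.keys \<mu> \<subseteq> S"
  shows "mdeg \<mu> = (\<Sum>m\<in>S. Poly_Mapping.lookup \<mu> m)"
  using assms by (intro sum.mono_neutral_left) (auto simp: in_keys_iff)

lemma mdeg_add_single_1: "mdeg (\<mu> + Poly_Mapping.single m 1) = Suc (mdeg \<mu>)"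
proof -
  let ?S = "insert m (Poly_Mapping.keys \<mu>)"
  have "mdeg (\<mu> + Poly_Mapping.single m 1)
      = (\<Sum>n\<in>?S. Poly_Mapping.lookup \<mu> n + (if n = m then 1 else 0))"
    unfolding keys_add_single_1 by (intro sum.cong) (auto simp: lookup_add lookup_single when_def)
  also have "\<dots> = (\<Sum>n\<in>?S. Poly_Mapping.lookup \<mu> n) + 1"
    unfolding sum.distrib by simp
  also have "(\<Sum>n\<in>?S. Poly_Mapping.lookup \<mu> n) = mdeg \<mu>"
    by (rule mdeg_eq_sum[symmetric]) auto
  finally show ?thesis by simp
qed

text \<open>Removing one occurrence of a variable lowers the degree. Through this induction the laws
  of the coproduct follow from grouplike elements and primitive variables, without products of
  binomial coefficients.\<close>

lemma monomial_induct [case_names zero step]: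
  assumes zero: "P 0" and step: "\<And>\<mu> m. P \<mu> \<Longrightarrow> P (\<mu> + Poly_Mapping.single m 1)"
  shows "P (\<mu> :: nat \<Rightarrow>\<^sub>0 nat)"
proof (induction "mdeg \<mu>" arbitrary: \<mu>)
  case 0
  then have "\<mu> = 0"
    by (intro poly_mapping_eqI) (auto simp: in_keys_iff)
  then show ?case using zero by simp
next
  case (Suc n)
  then obtain m where m: "m \<in> Poly_Mapping.keys \<mu>"
    by (metis sum.empty all_not_in_conv nat.distinct(1))
  define \<nu> where "\<nu> = \<mu> - Poly_Mapping.single m 1"
  have eq: "\<mu> = \<nu> + Poly_Mapping.single m 1"
    unfolding \<nu>_def using m
    by (intro poly_mapping_eqI) (auto simp: lookup_add lookup_minus lookup_single when_def in_keys_iff)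
  have "mdeg \<nu> = n"
    using Suc(2) mdeg_add_single_1[of \<nu> m] unfolding eq by linarith
  from step[OF Suc(1)[OF this[symmetric]], of m] show ?case
    unfolding eq[symmetric] .
qed

definition xgen :: "nat \<Rightarrow> 'k bas" where
  "xgen m = (0, Poly_Mapping.single m 1)"

lemma xgen_sel [simp]: "fst (xgen m) = 0" "snd (xgen m) = Poly_Mapping.single m 1"
  by (simp_all add: xgen_def)

lemma bas_induct [case_names group step]:
  assumes group: "\<And>\<alpha>. P (\<alpha>, 0)" and step: "\<And>u m. P u \<Longrightarrow> P (u + xgen m)"
  shows "P (u :: 'k bas)"
proof -
  have "P (\<alpha>, \<mu>)" for \<alpha> \<mu>
  proof (induction \<mu> rule: monomial_induct)
    case (step \<mu> m)
    from assms(2)[OF this, of m] show ?case by (simp add: xgen_def)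
  qed (rule group)
  then show ?thesis by (cases u) auto
qed

lemma bas_cases [case_names group step]:
  obtains \<alpha> where "u = (\<alpha>, 0)" | w m where "u = w + xgen m"
  by (induction u rule: bas_induct) blast+

lemma divs_iff: "\<nu> \<in> divs \<mu> \<longleftrightarrow> (\<forall>m. Poly_Mapping.lookup \<nu> m \<le> Poly_Mapping.lookup \<mu> m)"
  by (simp add: divs_def)

lemma divs_zero [simp]: "divs 0 = {0}"
  by (auto simp: divs_iff intro!: poly_mapping_eqI)

lemma finite_divs [simp, intro]: "finite (divs \<mu>)"
proof (induction \<mu> rule: monomial_induct)
  case (step \<mu> m)
  let ?e = "Poly_Mapping.single m 1 :: nat \<Rightarrow>\<^sub>0 nat"
  have "divs (\<mu> + ?e) \<subseteq> divs \<mu> \<union> (\<lambda>\<nu>. \<nu> + ?e) ` divs \<mu>"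
  proof
    fix \<nu> assume \<nu>: "\<nu> \<in> divs (\<mu> + ?e)"
    show "\<nu> \<in> divs \<mu> \<union> (\<lambda>\<nu>. \<nu> + ?e) ` divs \<mu>"
    proof (cases "\<nu> \<in> divs \<mu>")
      case False
      then obtain n where n: "Poly_Mapping.lookup \<nu> n > Poly_Mapping.lookup \<mu> n"
        by (auto simp: divs_iff not_le)
      have le: "Poly_Mapping.lookup \<nu> n \<le> Poly_Mapping.lookup \<mu> n + (if n = m then 1 else 0)" for n
        using \<nu> by (auto simp: divs_iff lookup_add lookup_single when_def split: if_splits dest!: spec[of _ n])
      have "n = m" using n le[of n] by (auto split: if_splits)
      have "\<nu> = (\<nu> - ?e) + ?e"
        using n \<open>n = m\<close>
        by (intro poly_mapping_eqI) (auto simp: lookup_add lookup_minus lookup_single when_def)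
      moreover have "\<nu> - ?e \<in> divs \<mu>"
        unfolding divs_iff
      proof
        fix j show "Poly_Mapping.lookup (\<nu> - ?e) j \<le> Poly_Mapping.lookup \<mu> j"
          using le[of j] by (auto simp: lookup_minus lookup_single when_def split: if_splits)
      qed
      ultimately show ?thesis by blast
    qed simp
  qed
  then show ?case using step finite_subset by blast
qed simp

lemma mbinom_eq_prod:
  assumes "finite S" "Poly_Mapping.keys \<mu> \<subseteq> S" "\<nu> \<in> divs \<mu>"
  shows "mbinom \<mu> \<nu> = (\<Prod>m\<in>S. Poly_Mapping.lookup \<mu> m choose Poly_Mapping.lookup \<nu> m)"
  unfolding mbinom_def
proof (rule prod.mono_neutral_left)
  show "\<forall>i\<in>S - Poly_Mapping.keys \<mu>. (Poly_Mapping.lookup \<mu> i choose Poly_Mapping.lookup \<nu> i) = 1"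
  proof
    fix i assume "i \<in> S - Poly_Mapping.keys \<mu>"
    then have "Poly_Mapping.lookup \<mu> i = 0" by (simp add: in_keys_iff)
    moreover from this have "Poly_Mapping.lookup \<nu> i = 0"
      using assms(3) by (metis divs_iff le_zero_eq)
    ultimately show "(Poly_Mapping.lookup \<mu> i choose Poly_Mapping.lookup \<nu> i) = 1" by simp
  qed
qed (use assms in auto)

lemma mbinom_self: "mbinom \<mu> \<mu> = 1"
  by (simp add: mbinom_def)

lemma mbinom_zero_right: "mbinom \<mu> 0 = 1"
  by (simp add: mbinom_def)

lemma mbinom_pos: "\<nu> \<in> divs \<mu> \<Longrightarrow> mbinom \<mu> \<nu> > 0"
  unfolding mbinom_def by (intro prod_pos) (simp add: divs_iff)

text \<open>Pascal's rule in the exponent of x_m; the other variables contribute a common factor.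
  The first guard matters because \<open>mbinom\<close> multiplies over the keys of
  \<open>\<mu>\<close> only, so it does not vanish when \<open>\<nu>\<close> contains an x_m absent
  from \<open>\<mu>\<close>. The second keeps truncated subtraction away from exponent 0.\<close>

lemma mbinom_Pascal:
  assumes \<nu>: "\<nu> \<in> divs (\<mu> + Poly_Mapping.single m 1)"
  shows "mbinom (\<mu> + Poly_Mapping.single m 1) \<nu> =
     (if \<nu> \<in> divs \<mu> then mbinom \<mu> \<nu> else 0)
     + (if Poly_Mapping.lookup \<nu> m = 0 then 0 else mbinom \<mu> (\<nu> - Poly_Mapping.single m 1))"
proof -
  let ?e = "Poly_Mapping.single m 1 :: nat \<Rightarrow>\<^sub>0 nat"
  let ?S = "insert m (Poly_Mapping.keys \<mu>)"
  define P where "P = (\<Prod>n\<in>?S - {m}. Poly_Mapping.lookup \<mu> n choose Poly_Mapping.lookup \<nu> n)"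
  have le: "Poly_Mapping.lookup \<nu> n \<le> Poly_Mapping.lookup \<mu> n + (if n = m then 1 else 0)" for n
    using \<nu> by (auto simp: divs_iff lookup_add lookup_single when_def split: if_splits dest!: spec[of _ n])
  have 1: "mbinom (\<mu> + ?e) \<nu> = (Suc (Poly_Mapping.lookup \<mu> m) choose Poly_Mapping.lookup \<nu> m) * P"
  proof -
    have "mbinom (\<mu> + ?e) \<nu> =
        (\<Prod>n\<in>?S. Poly_Mapping.lookup (\<mu> + ?e) n choose Poly_Mapping.lookup \<nu> n)"
      by (simp add: mbinom_def keys_add_single_1 del: One_nat_def)
    also have "\<dots> = (Poly_Mapping.lookup (\<mu> + ?e) m choose Poly_Mapping.lookup \<nu> m)
        * (\<Prod>n\<in>?S - {m}. Poly_Mapping.lookup (\<mu> + ?e) n choose Poly_Mapping.lookup \<nu> n)"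
      by (subst prod.remove[of _ m]) auto
    also have "(\<Prod>n\<in>?S - {m}. Poly_Mapping.lookup (\<mu> + ?e) n choose Poly_Mapping.lookup \<nu> n) = P"
      unfolding P_def by (intro prod.cong) (auto simp: lookup_add lookup_single when_def)
    finally show ?thesis by (simp add: lookup_add)
  qed
  have 2: "(if \<nu> \<in> divs \<mu> then mbinom \<mu> \<nu> else 0)
      = (Poly_Mapping.lookup \<mu> m choose Poly_Mapping.lookup \<nu> m) * P"
  proof (cases "\<nu> \<in> divs \<mu>")
    case True
    then have "mbinom \<mu> \<nu> = (\<Prod>n\<in>?S. Poly_Mapping.lookup \<mu> n choose Poly_Mapping.lookup \<nu> n)"
      by (intro mbinom_eq_prod) auto
    with True show ?thesis
      unfolding P_def by (subst (asm) prod.remove[of _ m]) auto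
  next
    case False
    then obtain n where n: "Poly_Mapping.lookup \<nu> n > Poly_Mapping.lookup \<mu> n"
      by (auto simp: divs_iff not_le)
    with le[of n] have "n = m" by (auto split: if_splits)
    with n False show ?thesis by simp
  qed
  have 3: "mbinom \<mu> (\<nu> - ?e) = (Poly_Mapping.lookup \<mu> m choose (Poly_Mapping.lookup \<nu> m - 1)) * P"
    if nz: "Poly_Mapping.lookup \<nu> m \<noteq> 0"
  proof -
    have "\<nu> - ?e \<in> divs \<mu>"
      unfolding divs_iff
    proof
      fix j show "Poly_Mapping.lookup (\<nu> - ?e) j \<le> Poly_Mapping.lookup \<mu> j"
        using le[of j] by (auto simp: lookup_minus lookup_single when_def split: if_splits)
    qed
    then have "mbinom \<mu> (\<nu> - ?e) =
        (\<Prod>n\<in>?S. Poly_Mapping.lookup \<mu> n choose Poly_Mapping.lookup (\<nu> - ?e) n)"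
      by (intro mbinom_eq_prod) auto
    also have "\<dots> = (Poly_Mapping.lookup \<mu> m choose Poly_Mapping.lookup (\<nu> - ?e) m)
        * (\<Prod>n\<in>?S - {m}. Poly_Mapping.lookup \<mu> n choose Poly_Mapping.lookup (\<nu> - ?e) n)"
      by (subst prod.remove[of _ m]) auto
    also have "(\<Prod>n\<in>?S - {m}. Poly_Mapping.lookup \<mu> n choose Poly_Mapping.lookup (\<nu> - ?e) n) = P"
      unfolding P_def by (intro prod.cong) (auto simp: lookup_minus lookup_single when_def)
    finally show ?thesis by (simp add: lookup_minus)
  qed
  show ?thesis
  proof (cases "Poly_Mapping.lookup \<nu> m")
    case 0
    then show ?thesis unfolding 1 2 by simp
  next
    case (Suc k)
    then have "(Suc (Poly_Mapping.lookup \<mu> m) choose Poly_Mapping.lookup \<nu> m) =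
      (Poly_Mapping.lookup \<mu> m choose Poly_Mapping.lookup \<nu> m) +
      (Poly_Mapping.lookup \<mu> m choose (Poly_Mapping.lookup \<nu> m - 1))"
      by simp
    then show ?thesis unfolding 1 2 using 3 Suc by (simp add: algebra_simps)
  qed
qed

subsection \<open>Summation over the coproduct of a basis element\<close>

text \<open>The Sweedler sum of F(u', u''). Multiplicities enter through \<open>of_nat\<close>, so
  that one definition serves values in A as well as in V \<otimes> A, which is also a commutative
  ring.\<close>

definition cop_sum :: "('k bas \<Rightarrow> 'k bas \<Rightarrow> 'b::comm_ring_1) \<Rightarrow> 'k bas \<Rightarrow> 'b" where
  "cop_sum F u = (\<Sum>\<nu>\<in>divs (snd u). of_nat (mbinom (snd u) \<nu>) * F (fst u, \<nu>) (fst u, snd u - \<nu>))"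

lemma cop_sum_cong:
  assumes "\<And>\<nu>. \<nu> \<in> divs (snd u) \<Longrightarrow> F (fst u, \<nu>) (fst u, snd u - \<nu>) = G (fst u, \<nu>) (fst u, snd u - \<nu>)"
  shows "cop_sum F u = cop_sum G u"
  unfolding cop_sum_def using assms by (intro sum.cong) auto

lemma cop_sum_group [simp]: "cop_sum F (\<alpha>, 0) = F (\<alpha>, 0) (\<alpha>, 0)"
  by (simp add: cop_sum_def mbinom_self)

lemma cop_sum_zero_bas [simp]: "cop_sum F 0 = F 0 0"
  unfolding zero_prod_def by simp

lemma cop_sum_add: "cop_sum (\<lambda>a b. F a b + G a b) u = cop_sum F u + cop_sum G u"
  by (simp add: cop_sum_def algebra_simps sum.distrib)

lemma cop_sum_zero [simp]: "cop_sum (\<lambda>a b. 0) u = 0"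
  by (simp add: cop_sum_def)

lemma cop_sum_mult_left: "cop_sum (\<lambda>a b. c * F a b) u = c * cop_sum F u"
  by (simp add: cop_sum_def sum_distrib_left mult_ac)

lemma cop_sum_mult_right: "cop_sum (\<lambda>a b. F a b * c) u = cop_sum F u * c"
  by (simp add: cop_sum_def sum_distrib_left sum_distrib_right mult_ac)

lemma cop_sum_sum: "cop_sum (\<lambda>a b. \<Sum>i\<in>I. F i a b) u = (\<Sum>i\<in>I. cop_sum (F i) u)"
  unfolding cop_sum_def sum_distrib_left by (rule sum.swap)

lemma cop_sum_commute:
  "cop_sum (\<lambda>a b. cop_sum (\<lambda>c d. F a b c d) v) u = cop_sum (\<lambda>c d. cop_sum (\<lambda>a b. F a b c d) u) v"
  unfolding cop_sum_def sum_distrib_left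
  by (subst sum.swap) (simp add: mult_ac)

text \<open>This is \<Delta>(u x_m) = \<Delta>(u) (x_m \<otimes> 1 + 1 \<otimes> x_m): Pascal's rule
  splits the divisors by the leg that receives the new x_m. The structural laws of the coproduct
  below are inductions along this recursion.\<close>

lemma cop_sum_add_xgen:
  "cop_sum F (u + xgen m) = cop_sum (\<lambda>a b. F (a + xgen m) b + F a (b + xgen m)) u"
proof -
  obtain \<alpha> \<mu> where u: "u = (\<alpha>, \<mu>)" by (cases u)
  let ?e = "Poly_Mapping.single m 1 :: nat \<Rightarrow>\<^sub>0 nat"
  let ?G = "\<lambda>\<nu>. F (\<alpha>, \<nu>) (\<alpha>, \<mu> + ?e - \<nu>)"
  have sub: "divs \<mu> \<subseteq> divs (\<mu> + ?e)"
    unfolding divs_iff subset_iff lookup_add by (meson le_add1 le_trans)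
  have "cop_sum F (u + xgen m) = (\<Sum>\<nu>\<in>divs (\<mu> + ?e). of_nat (mbinom (\<mu> + ?e) \<nu>) * ?G \<nu>)"
    by (simp add: u xgen_def cop_sum_def)
  also have "\<dots> = (\<Sum>\<nu>\<in>divs (\<mu> + ?e).
       (if \<nu> \<in> divs \<mu> then of_nat (mbinom \<mu> \<nu>) * ?G \<nu> else 0)
     + (if Poly_Mapping.lookup \<nu> m = 0 then 0 else of_nat (mbinom \<mu> (\<nu> - ?e)) * ?G \<nu>))"
    by (intro sum.cong) (auto simp: mbinom_Pascal algebra_simps simp del: One_nat_def)
  also have "\<dots> = (\<Sum>\<nu>\<in>divs (\<mu> + ?e). if \<nu> \<in> divs \<mu> then of_nat (mbinom \<mu> \<nu>) * ?G \<nu> else 0)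
     + (\<Sum>\<nu>\<in>divs (\<mu> + ?e). if Poly_Mapping.lookup \<nu> m = 0 then 0 else of_nat (mbinom \<mu> (\<nu> - ?e)) * ?G \<nu>)"
    by (rule sum.distrib)
  also have "(\<Sum>\<nu>\<in>divs (\<mu> + ?e). if \<nu> \<in> divs \<mu> then of_nat (mbinom \<mu> \<nu>) * ?G \<nu> else 0)
      = (\<Sum>\<nu>\<in>divs \<mu>. of_nat (mbinom \<mu> \<nu>) * F (\<alpha>, \<nu>) ((\<alpha>, \<mu> - \<nu>) + xgen m))"
  proof (rule sum.mono_neutral_cong_right)
    fix \<nu> assume \<nu>: "\<nu> \<in> divs \<mu>"
    then have "\<mu> + ?e - \<nu> = (\<mu> - \<nu>) + ?e"
      by (intro poly_mapping_eqI) (auto simp: lookup_add lookup_minus divs_iff)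
    with \<nu> show "(if \<nu> \<in> divs \<mu> then of_nat (mbinom \<mu> \<nu>) * ?G \<nu> else 0)
       = of_nat (mbinom \<mu> \<nu>) * F (\<alpha>, \<nu>) ((\<alpha>, \<mu> - \<nu>) + xgen m)"
      by (simp add: xgen_def)
  qed (use sub in auto)
  also have "(\<Sum>\<nu>\<in>divs (\<mu> + ?e). if Poly_Mapping.lookup \<nu> m = 0 then 0 else of_nat (mbinom \<mu> (\<nu> - ?e)) * ?G \<nu>)
      = (\<Sum>\<nu>\<in>{\<nu>\<in>divs (\<mu> + ?e). Poly_Mapping.lookup \<nu> m \<noteq> 0}. of_nat (mbinom \<mu> (\<nu> - ?e)) * ?G \<nu>)"
    by (rule sum.mono_neutral_cong_right) auto
  \<comment> \<open>Here the new x_m lies in the left leg; since x_m occurs in \<open>\<nu>\<close>,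
    subtracting \<open>?e\<close> is invertible.\<close>
  also have "\<dots> = (\<Sum>\<nu>\<in>divs \<mu>. of_nat (mbinom \<mu> \<nu>) * F ((\<alpha>, \<nu>) + xgen m) (\<alpha>, \<mu> - \<nu>))"
  proof (rule sum.reindex_bij_witness[where i = "\<lambda>\<nu>. \<nu> + ?e" and j = "\<lambda>\<nu>. \<nu> - ?e"])
    fix \<nu> assume \<nu>: "\<nu> \<in> {\<nu> \<in> divs (\<mu> + ?e). Poly_Mapping.lookup \<nu> m \<noteq> 0}"
    then show eq: "\<nu> - ?e + ?e = \<nu>"
      by (intro poly_mapping_eqI) (auto simp: lookup_add lookup_minus lookup_single when_def)
    show "\<nu> - ?e \<in> divs \<mu>"
      unfolding divs_iff
    proof
      fix j
      have "Poly_Mapping.lookup \<nu> j \<le> Poly_Mapping.lookup (\<mu> + ?e) j" using \<nu> by (simp add: divs_iff)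
      then show "Poly_Mapping.lookup (\<nu> - ?e) j \<le> Poly_Mapping.lookup \<mu> j"
        by (auto simp: lookup_minus lookup_add lookup_single when_def split: if_splits)
    qed
    have "\<mu> - (\<nu> - ?e) = \<mu> + ?e - \<nu>"
      using \<nu> by (intro poly_mapping_eqI) (auto simp: lookup_add lookup_minus lookup_single when_def)
    with eq show "of_nat (mbinom \<mu> (\<nu> - ?e)) * F ((\<alpha>, \<nu> - ?e) + xgen m) (\<alpha>, \<mu> - (\<nu> - ?e))
       = of_nat (mbinom \<mu> (\<nu> - ?e)) * ?G \<nu>"
      by (simp add: xgen_def)
  next
    fix \<nu> assume "\<nu> \<in> divs \<mu>"
    then show "\<nu> + ?e \<in> {\<nu> \<in> divs (\<mu> + ?e). Poly_Mapping.lookup \<nu> m \<noteq> 0}"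
      by (auto simp: divs_iff lookup_add)
  qed simp
  finally show ?thesis
    by (simp add: u cop_sum_def algebra_simps sum.distrib)
qed

lemma cop_sum_xgen: "cop_sum F (xgen m) = F (xgen m) 0 + F 0 (xgen m)"
  using cop_sum_add_xgen[of F 0 m] by simp

text \<open>Cocommutativity: the recursion is symmetric in the two legs, and a grouplike element has
  equal legs.\<close>

lemma cop_sum_flip: "cop_sum F u = cop_sum (\<lambda>a b. F b a) u"
proof (induction u arbitrary: F rule: bas_induct)
  case (step u m)
  show ?case
    unfolding cop_sum_add_xgen by (subst step) (simp add: add.commute)
qed simp

text \<open>Coassociativity: under either bracketing a new x_m goes to one of the same three
  legs.\<close>

lemma cop_sum_assoc:
  "cop_sum (\<lambda>a b. cop_sum (\<lambda>c d. F c d b) a) u = cop_sum (\<lambda>a b. cop_sum (\<lambda>c d. F a c d) b) u"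
  by (induction u arbitrary: F rule: bas_induct)
     (simp_all add: cop_sum_add_xgen add_ac cop_sum_add)

lemma cop_sum_add_group:
  "cop_sum F (u + (\<beta>, 0)) = cop_sum (\<lambda>a b. F (a + (\<beta>, 0)) (b + (\<beta>, 0))) u"
  by (cases u) (simp add: cop_sum_def)

lemma cop_sum_plus:
  "cop_sum F (u + v) = cop_sum (\<lambda>a b. cop_sum (\<lambda>c d. F (a + c) (b + d)) v) u"
proof (induction v arbitrary: F rule: bas_induct)
  case (group \<alpha>)
  then show ?case by (simp add: cop_sum_add_group)
next
  case (step v m)
  show ?case
    unfolding add.assoc[of u, symmetric] cop_sum_add_xgen step by (simp add: add.assoc)
qed

section \<open>The fourfold coproduct and permutations of its legs\<close>

definition cop_sum4 :: "('k bas \<Rightarrow> 'k bas \<Rightarrow> 'k bas \<Rightarrow> 'k bas \<Rightarrow> 'b::comm_ring_1) \<Rightarrow> 'k bas \<Rightarrow> 'b" where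
  "cop_sum4 F u = cop_sum (\<lambda>a b. cop_sum (\<lambda>p q. cop_sum (\<lambda>s t. F p q s t) b) a) u"

lemma cop_sum4_group [simp]: "cop_sum4 F (\<alpha>, 0) = F (\<alpha>, 0) (\<alpha>, 0) (\<alpha>, 0) (\<alpha>, 0)"
  by (simp add: cop_sum4_def)

lemma cop_sum4_add_xgen:
  "cop_sum4 F (u + xgen m) = cop_sum4 (\<lambda>p q s t. F (p + xgen m) q s t + F p (q + xgen m) s t
     + F p q (s + xgen m) t + F p q s (t + xgen m)) u"
  by (simp add: cop_sum4_def cop_sum_add_xgen cop_sum_add add_ac)

text \<open>The recursion treats the four legs alike, so any permutation of them is allowed; this
  one and the next are those that the multiplicativity of R uses.\<close>

lemma cop_sum4_swap_mid: "cop_sum4 F u = cop_sum4 (\<lambda>p q s t. F p s q t) u"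
  by (induction u arbitrary: F rule: bas_induct) (simp_all add: cop_sum4_add_xgen add_ac)

lemma cop_sum4_rotate: "cop_sum4 F u = cop_sum4 (\<lambda>p q s t. F t p s q) u"
  by (induction u arbitrary: F rule: bas_induct) (simp_all add: cop_sum4_add_xgen add_ac)

subsection \<open>Linear maps over the coefficient ring\<close>

lemma lookup_smul [simp]: "Poly_Mapping.lookup (smul s f) k = s * Poly_Mapping.lookup f k"
  by (simp add: smul_def Poly_Mapping.map.rep_eq when_def)

lemma smul_add_right: "smul s (f + g) = smul s f + smul s g"
  by (rule poly_mapping_eqI) (simp add: lookup_add algebra_simps)

lemma smul_add_left: "smul (s + t) f = smul s f + smul t f"
  by (rule poly_mapping_eqI) (simp add: lookup_add algebra_simps)

lemma smul_smul: "smul s (smul t f) = smul (s * t) f"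
  by (rule poly_mapping_eqI) (simp add: mult.assoc)

lemma smul_zero_left [simp]: "smul 0 f = 0" and smul_zero_right [simp]: "smul s 0 = 0"
  by (auto intro: poly_mapping_eqI)

lemma smul_one [simp]: "smul (1 :: 'a::comm_semiring_1) f = f"
  by (rule poly_mapping_eqI) simp

lemma smul_sum_right: "smul s (\<Sum>i\<in>I. f i) = (\<Sum>i\<in>I. smul s (f i))"
  by (induction I rule: infinite_finite_induct) (auto simp: smul_add_right)

lemma smul_sum_left: "smul (\<Sum>i\<in>I. s i) f = (\<Sum>i\<in>I. smul (s i) f)"
  by (induction I rule: infinite_finite_induct) (auto simp: smul_add_left)

lemma smul_bv: "smul s (bv u) = Poly_Mapping.single u (s :: 'a::comm_semiring_1)"
  by (rule poly_mapping_eqI) (simp add: bv_def lookup_single when_def)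

lemma smul_single: "smul s (Poly_Mapping.single u t) = Poly_Mapping.single u (s * t)"
  by (rule poly_mapping_eqI) (simp add: lookup_single when_def)

lemma bv_mult: "bv u * bv v = (bv (u + v) :: _ \<Rightarrow>\<^sub>0 'a::comm_semiring_1)"
  by (simp add: bv_def mult_single)

lemma bv_zero: "bv 0 = 1"
  by (simp add: bv_def)

definition A_linear :: "(('b \<Rightarrow>\<^sub>0 'a::comm_ring_1) \<Rightarrow> ('c \<Rightarrow>\<^sub>0 'a)) \<Rightarrow> bool" where
  "A_linear L \<longleftrightarrow> (\<forall>f g. L (f + g) = L f + L g) \<and> (\<forall>s f. L (smul s f) = smul s (L f))"

lemma A_linearI:
  assumes "\<And>f g. L (f + g) = L f + L g" "\<And>s f. L (smul s f) = smul s (L f)"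
  shows "A_linear L"
  using assms by (simp add: A_linear_def)

lemma A_linear_add: "A_linear L \<Longrightarrow> L (f + g) = L f + L g"
  and A_linear_smul: "A_linear L \<Longrightarrow> L (smul s f) = smul s (L f)"
  by (simp_all add: A_linear_def)

lemma A_linear_zero: "A_linear L \<Longrightarrow> L 0 = 0"
  using A_linear_smul[of L 0 0] by simp

lemma A_linear_sum: "A_linear L \<Longrightarrow> L (\<Sum>i\<in>I. f i) = (\<Sum>i\<in>I. L (f i))"
  by (induction I rule: infinite_finite_induct) (auto simp: A_linear_add A_linear_zero)

lemma poly_mapping_eq_sum_bv:
  "f = (\<Sum>u\<in>Poly_Mapping.keys f. smul (Poly_Mapping.lookup f u) (bv u :: _ \<Rightarrow>\<^sub>0 'a::comm_ring_1))"
  by (rule poly_mapping_eqI)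
     (auto simp: lookup_sum smul_bv lookup_single when_def in_keys_iff)

lemma smul_mult_left: "smul s f * g = smul s (f * (g :: 'b::cancel_comm_monoid_add \<Rightarrow>\<^sub>0 'a::comm_ring_1))"
proof -
  \<comment> \<open>Scaling is multiplication by a constant, so associativity of the ring moves
    it.\<close>
  have eq: "smul s f = Poly_Mapping.single 0 s * f" for f :: "'b \<Rightarrow>\<^sub>0 'a"
    by (subst (1 2) poly_mapping_eq_sum_bv)
       (simp add: smul_sum_right smul_bv smul_single sum_distrib_left mult_single)
  show ?thesis by (simp add: eq mult.assoc)
qed

lemma smul_mult_right: "f * smul s g = smul s (f * (g :: 'b::cancel_comm_monoid_add \<Rightarrow>\<^sub>0 'a::comm_ring_1))"
  using smul_mult_left[of s g f] by (simp add: mult.commute)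

lemma smul_of_nat: "smul (of_nat n) f = of_nat n * (f :: 'b::cancel_comm_monoid_add \<Rightarrow>\<^sub>0 'a::comm_ring_1)"
  by (induction n) (simp_all add: smul_add_left distrib_right)

lemma A_linear_eqI:
  assumes "A_linear L" "A_linear M" "\<And>u. L (bv u) = M (bv u)"
  shows "L f = M f"
  by (subst (1 2) poly_mapping_eq_sum_bv) (simp add: A_linear_sum A_linear_smul assms)

lemma lin_ext_eq_sum:
  assumes "finite S" "Poly_Mapping.keys f \<subseteq> S"
  shows "lin_ext T f = (\<Sum>u\<in>S. smul (Poly_Mapping.lookup f u) (T u))"
  unfolding lin_ext_def using assms by (intro sum.mono_neutral_left) (auto simp: in_keys_iff)

lemma A_linear_lin_ext: "A_linear (lin_ext (T :: 'b \<Rightarrow> _ \<Rightarrow>\<^sub>0 'a::comm_ring_1))"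
proof (rule A_linearI)
  fix f g :: "'b \<Rightarrow>\<^sub>0 'a"
  let ?S = "Poly_Mapping.keys f \<union> Poly_Mapping.keys g"
  have "Poly_Mapping.keys (f + g) \<subseteq> ?S" by (rule Poly_Mapping.keys_add)
  then show "lin_ext T (f + g) = lin_ext T f + lin_ext T g"
    by (simp add: lin_ext_eq_sum[of ?S] lookup_add smul_add_left sum.distrib)
next
  fix s and f :: "'b \<Rightarrow>\<^sub>0 'a"
  have "Poly_Mapping.keys (smul s f) \<subseteq> Poly_Mapping.keys f"
    by (auto simp: in_keys_iff)
  then show "lin_ext T (smul s f) = smul s (lin_ext T f)"
    by (simp add: lin_ext_eq_sum[of "Poly_Mapping.keys f"] smul_sum_right smul_smul)
qed

lemma lin_ext_bv [simp]: "lin_ext T (bv u :: _ \<Rightarrow>\<^sub>0 'a::comm_ring_1) = T u"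
  by (simp add: lin_ext_def bv_def)

text \<open>The multiplicities in \<Delta> are natural numbers, so additivity alone carries
  \<open>L\<close> through the sum.\<close>

lemma additive_cop_sum:
  assumes "\<And>x y. L (x + y) = L x + L y"
  shows "L (cop_sum F u) = cop_sum (\<lambda>a b. L (F a b)) u"
proof -
  have zero: "L 0 = 0" using assms[of 0 0] by simp
  have "L (of_nat n * x) = of_nat n * L x" for n x
    by (induction n) (simp_all add: zero assms distrib_right)
  moreover have "L (\<Sum>i\<in>I. f i) = (\<Sum>i\<in>I. L (f i))" for f and I :: "(nat \<Rightarrow>\<^sub>0 nat) set"
    by (induction I rule: infinite_finite_induct) (auto simp: zero assms)
  ultimately show ?thesis by (simp add: cop_sum_def)
qed

lemma cop_sum_linear: "A_linear L \<Longrightarrow> L (cop_sum F u) = cop_sum (\<lambda>a b. L (F a b)) u"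
  by (rule additive_cop_sum) (rule A_linear_add)

lemma smul_cop_sum_right: "smul s (cop_sum F u) = cop_sum (\<lambda>a b. smul s (F a b)) u"
  by (rule additive_cop_sum) (rule smul_add_right)

lemma smul_cop_sum_left: "smul (cop_sum F u) y = cop_sum (\<lambda>a b. smul (F a b) y) u"
  by (rule additive_cop_sum) (rule smul_add_left)

subsection \<open>The convolution algebra of functionals on the basis\<close>

definition counit :: "'k bas \<Rightarrow> 'a::comm_ring_1" where
  "counit u = (if snd u = 0 then 1 else 0)"

definition conv :: "('k bas \<Rightarrow> 'a::comm_ring_1) \<Rightarrow> ('k bas \<Rightarrow> 'a) \<Rightarrow> 'k bas \<Rightarrow> 'a" where
  "conv d e u = cop_sum (\<lambda>a b. d a * e b) u"

lemma counit_group [simp]: "counit (\<alpha>, 0) = 1"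
  by (simp add: counit_def)

lemma counit_zero [simp]: "counit 0 = 1"
  by (simp add: counit_def)

lemma add_single_1_neq_0: "(\<mu> :: nat \<Rightarrow>\<^sub>0 nat) + Poly_Mapping.single m 1 \<noteq> 0"
  using mdeg_add_single_1[of \<mu> m] by (metis keys_zero nat.distinct(1) sum.empty)

lemma counit_add_xgen [simp]: "counit (u + xgen m) = 0"
  using add_single_1_neq_0 by (simp add: counit_def)

lemma counit_xgen [simp]: "counit (xgen m) = 0"
  using counit_add_xgen[of 0] by simp

lemma conv_group [simp]: "conv d e (\<alpha>, 0) = d (\<alpha>, 0) * e (\<alpha>, 0)"
  by (simp add: conv_def)

lemma conv_commute: "conv d e = conv e d"
  unfolding conv_def by (intro ext, subst cop_sum_flip) (simp add: mult.commute)

lemma conv_assoc: "conv (conv d e) f = conv d (conv e f)"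
proof
  fix u
  have "conv (conv d e) f u = cop_sum (\<lambda>a b. cop_sum (\<lambda>p q. d p * e q * f b) a) u"
    by (simp add: conv_def cop_sum_mult_right)
  also have "\<dots> = conv d (conv e f) u"
    unfolding cop_sum_assoc by (simp add: conv_def mult.assoc flip: cop_sum_mult_left)
  finally show "conv (conv d e) f u = conv d (conv e f) u" .
qed

lemma conv_left_commute: "conv d (conv e f) = conv e (conv d f)"
  by (metis conv_assoc conv_commute)

lemma conv_add_xgen:
  "conv d e (u + xgen m) = conv (\<lambda>u. d (u + xgen m)) e u + conv d (\<lambda>u. e (u + xgen m)) u"
  by (simp add: conv_def cop_sum_add_xgen cop_sum_add)

lemma conv_zero_left [simp]: "conv (\<lambda>u. 0) e u = 0"
  and conv_zero_right [simp]: "conv d (\<lambda>u. 0) u = 0"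
  by (simp_all add: conv_def)

lemma conv_add_left: "conv (\<lambda>u. d u + d' u) e u = conv d e u + conv d' e u"
  by (simp add: conv_def cop_sum_add distrib_right)

lemma conv_mult_left: "conv (\<lambda>u. s * d u) e u = s * conv d e u"
  by (simp add: conv_def cop_sum_mult_left mult.assoc)

lemma conv_mult_right: "conv d (\<lambda>u. s * e u) u = s * conv d e u"
  using conv_mult_left by (metis conv_commute)

lemma conv_sum_right: "conv d (\<lambda>u. \<Sum>i\<in>I. e i u) u = (\<Sum>i\<in>I. conv d (e i) u)"
  by (simp add: conv_def sum_distrib_left cop_sum_sum)

lemma cop_sum_group_left:
  assumes "\<And>a b. snd a \<noteq> 0 \<Longrightarrow> F a b = 0"
  shows "cop_sum F u = F (fst u, 0) u"
proof -
  have "cop_sum F u = (\<Sum>\<nu>\<in>{0}. of_nat (mbinom (snd u) \<nu>) * F (fst u, \<nu>) (fst u, snd u - \<nu>))"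
    unfolding cop_sum_def by (rule sum.mono_neutral_right) (auto simp: assms divs_iff)
  then show ?thesis by (simp add: mbinom_zero_right)
qed

lemma conv_counit_left [simp]: "conv counit e u = e u"
  unfolding conv_def by (subst cop_sum_group_left) (auto simp: counit_def)

lemma conv_counit_right [simp]: "conv e counit u = e u"
  by (metis conv_commute conv_counit_left)

abbreviation bdeg :: "'k bas \<Rightarrow> nat" where
  "bdeg u \<equiv> mdeg (snd u)"

lemma keys_divs: "\<nu> \<in> divs \<mu> \<Longrightarrow> Poly_Mapping.keys \<nu> \<subseteq> Poly_Mapping.keys \<mu>"
  by (auto simp: divs_iff in_keys_iff) (metis gr0I le_zero_eq less_numeral_extra(3))

lemma mdeg_mono:
  assumes "\<nu> \<in> divs \<mu>"
  shows "mdeg \<nu> \<le> mdeg \<mu>"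
proof -
  have "mdeg \<nu> = (\<Sum>m\<in>Poly_Mapping.keys \<mu>. Poly_Mapping.lookup \<nu> m)"
    using keys_divs[OF assms] by (intro mdeg_eq_sum) auto
  also have "\<dots> \<le> mdeg \<mu>"
    using assms by (intro sum_mono) (auto simp: divs_iff)
  finally show ?thesis .
qed

lemma diff_in_divs: "\<mu> - \<nu> \<in> divs (\<mu> :: nat \<Rightarrow>\<^sub>0 nat)"
  by (simp add: divs_iff lookup_minus)

lemma bdeg_add_xgen: "bdeg (u + xgen m) = Suc (bdeg u)"
  using mdeg_add_single_1 by simp

text \<open>The legs of \<open>u\<close> never exceed its degree. This locality serves the
  truncation of series and the induction on degree behind uniqueness.\<close>

lemma conv_cong_bdeg:
  assumes "\<And>w. bdeg w \<le> bdeg u \<Longrightarrow> e w = e' w"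
  shows "conv d e u = conv d e' u"
  unfolding conv_def using assms mdeg_mono[OF diff_in_divs]
  by (intro cop_sum_cong) auto

text \<open>The derivative of \<open>F\<close> in direction \<open>x\<^sub>m\<close> is the transpose \<open>u \<mapsto> F (u x\<^sub>m)\<close> of multiplication,
  a derivation for convolution because \<open>x\<^sub>m\<close> is primitive.\<close>

definition logderiv :: "(nat \<Rightarrow> 'k bas \<Rightarrow> 'a::comm_ring_1) \<Rightarrow> ('k bas \<Rightarrow> 'a) \<Rightarrow> bool" where
  "logderiv g F \<longleftrightarrow> (\<forall>u m. F (u + xgen m) = conv (g m) F u)"

text \<open>By the Leibniz rule the derivative hits \<open>F\<close> or \<open>G\<close>;
  commutativity pulls the factor \<open>h m\<close> out past \<open>F\<close>.\<close>

lemma logderiv_conv: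
  assumes "logderiv g F" "logderiv h G"
  shows "logderiv (\<lambda>m u. g m u + h m u) (conv F G)"
proof -
  have F: "(\<lambda>u. F (u + xgen m)) = conv (g m) F" and G: "(\<lambda>u. G (u + xgen m)) = conv (h m) G" for m
    using assms by (auto simp: logderiv_def)
  show ?thesis
    unfolding logderiv_def
    by (simp add: conv_add_xgen F G conv_add_left conv_assoc conv_left_commute[of F])
qed

text \<open>The value at w x_m involves the functional only up to the degree of w, which is one
  less, so the equation is a recursion starting at the grouplike elements.\<close>

lemma logderiv_unique:
  assumes F: "logderiv g F" and G: "logderiv g G" and init: "\<And>\<alpha>. F (\<alpha>, 0) = G (\<alpha>, 0)"
  shows "F u = G u"
proof -
  have "bdeg u \<le> n \<Longrightarrow> F u = G u" for n u
  proof (induction n arbitrary: u)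
    case 0
    then have "snd u = 0"
      by (intro poly_mapping_eqI) (auto simp: in_keys_iff)
    then show ?case using init by (metis prod.collapse)
  next
    case (Suc n)
    show ?case
    proof (cases u rule: bas_cases)
      case (step w m)
      with Suc.prems have "bdeg w \<le> n" by (metis bdeg_add_xgen Suc_le_mono)
      then have "conv (g m) F w = conv (g m) G w"
        by (intro conv_cong_bdeg Suc.IH) auto
      then show ?thesis using F G step by (metis logderiv_def)
    qed (use init in simp)
  qed
  then show ?thesis by blast
qed

section \<open>Powers and exponential for convolution\<close>

fun cpow :: "('k bas \<Rightarrow> 'a::comm_ring_1) \<Rightarrow> nat \<Rightarrow> 'k bas \<Rightarrow> 'a" where
  "cpow d 0 = counit"
| "cpow d (Suc n) = conv d (cpow d n)"

text \<open>The rule (d^(n+1))' = (n+1) d' d^n, valid because convolution is commutative.\<close>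

lemma cpow_add_xgen:
  "cpow d (Suc n) (u + xgen m) = of_nat (Suc n) * conv (\<lambda>u. d (u + xgen m)) (cpow d n) u"
proof (induction n arbitrary: u)
  case 0
  show ?case by (simp add: conv_add_xgen)
next
  case (Suc n)
  let ?D = "\<lambda>u. d (u + xgen m)"
  have "cpow d (Suc (Suc n)) (u + xgen m)
      = conv ?D (cpow d (Suc n)) u + conv d (\<lambda>u. cpow d (Suc n) (u + xgen m)) u"
    by (simp only: cpow.simps(2)[of d "Suc n"] conv_add_xgen)
  also have "conv d (\<lambda>u. cpow d (Suc n) (u + xgen m)) u = of_nat (Suc n) * conv d (conv ?D (cpow d n)) u"
    unfolding Suc conv_mult_right ..
  also have "conv d (conv ?D (cpow d n)) = conv ?D (cpow d (Suc n))"
    unfolding cpow.simps by (rule conv_left_commute)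
  finally show ?case
    by (simp add: distrib_right del: cpow.simps)
qed

text \<open>Each factor consumes at least one variable. The derivative rule makes this an induction
  in which the power and the degree drop together.\<close>

lemma cpow_eq_0:
  assumes d: "\<And>\<alpha>. d (\<alpha>, 0) = 0" and "bdeg u < n"
  shows "cpow d n u = 0"
  using assms(2)
proof (induction n arbitrary: u)
  case (Suc n)
  show ?case
  proof (cases u rule: bas_cases)
    case (step w m)
    with Suc.prems have "bdeg w < n" by (metis bdeg_add_xgen Suc_less_eq)
    then have "conv (\<lambda>u. d (u + xgen m)) (cpow d n) w = conv (\<lambda>u. d (u + xgen m)) (\<lambda>u. 0) w"
      by (intro conv_cong_bdeg Suc.IH) auto
    then show ?thesis unfolding step cpow_add_xgen by simp
  qed (simp add: d)
qed simp

lemma C_algebra_hom_rules: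
  assumes "C_algebra_hom \<iota>"
  shows "\<iota> 1 = 1" "\<iota> (x + y) = \<iota> x + \<iota> y" "\<iota> (x * y) = \<iota> x * \<iota> y" "\<iota> 0 = 0" "\<iota> (of_nat n) = of_nat n"
proof -
  show [simp]: "\<iota> 1 = 1" "\<iota> (x + y) = \<iota> x + \<iota> y" "\<iota> (x * y) = \<iota> x * \<iota> y" for x y
    using assms by (auto simp: C_algebra_hom_def)
  have "\<iota> (0 + 0) = \<iota> 0 + \<iota> 0" by (simp del: add_0_right add_0_left)
  then show [simp]: "\<iota> 0 = 0" by simp
  show "\<iota> (of_nat n) = of_nat n" by (induction n) simp_all
qed

lemma C_algebra_hom_inverse_fact_Suc:
  assumes "C_algebra_hom \<iota>"
  shows "\<iota> (1 / of_nat (fact (Suc n))) * of_nat (Suc n) = \<iota> (1 / of_nat (fact n))"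
proof -
  have "\<iota> (1 / of_nat (fact (Suc n))) * of_nat (Suc n) = \<iota> (1 / of_nat (fact (Suc n)) * of_nat (Suc n))"
    unfolding C_algebra_hom_rules[OF assms] ..
  also have "1 / of_nat (fact (Suc n)) * of_nat (Suc n) = (1 / of_nat (fact n) :: complex)"
    unfolding fact_Suc of_nat_mult of_nat_id by (simp del: of_nat_Suc)
  finally show ?thesis .
qed

text \<open>The exponential series cut at the degree of the argument; by \<open>cpow_eq_0\<close>
  the cut discards only zero terms when \<open>d\<close> vanishes on grouplike elements.\<close>

definition cexp :: "(complex \<Rightarrow> 'a::comm_ring_1) \<Rightarrow> ('k bas \<Rightarrow> 'a) \<Rightarrow> 'k bas \<Rightarrow> 'a" where
  "cexp \<iota> d u = (\<Sum>n\<le>bdeg u. \<iota> (1 / of_nat (fact n)) * cpow d n u)"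

lemma cexp_eq_sum:
  assumes "\<And>\<alpha>. d (\<alpha>, 0) = 0" "bdeg u \<le> N"
  shows "cexp \<iota> d u = (\<Sum>n\<le>N. \<iota> (1 / of_nat (fact n)) * cpow d n u)"
  unfolding cexp_def using assms(2)
  by (intro sum.mono_neutral_left) (auto simp: cpow_eq_0[of d, OF assms(1)])

lemma cexp_group:
  assumes "C_algebra_hom \<iota>"
  shows "cexp \<iota> d (\<alpha>, 0) = 1"
  by (simp add: cexp_def C_algebra_hom_rules[OF assms])

lemma logderiv_cexp:
  fixes d :: "'b bas \<Rightarrow> 'a::comm_ring_1"
  assumes \<iota>: "C_algebra_hom \<iota>" and d: "\<And>\<alpha>. d (\<alpha>, 0) = 0"
  shows "logderiv (\<lambda>m u. d (u + xgen m)) (cexp \<iota> d)"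
  unfolding logderiv_def
proof (intro allI)
  fix u :: "'b bas" and m
  let ?D = "\<lambda>u. d (u + xgen m)" and ?N = "bdeg u"
  have "cexp \<iota> d (u + xgen m)
      = (\<Sum>n\<le>Suc ?N. \<iota> (1 / of_nat (fact n)) * cpow d n (u + xgen m))"
    by (rule cexp_eq_sum) (use d in \<open>simp_all only: bdeg_add_xgen order_refl\<close>)
  \<comment> \<open>The term n = 0 is the counit, which vanishes at u x_m. After the shift the
    factor n+1 from differentiation cancels against the factorial.\<close>
  also have "\<dots> = (\<Sum>n\<le>?N. \<iota> (1 / of_nat (fact (Suc n))) * cpow d (Suc n) (u + xgen m))"
    by (subst sum.atMost_Suc_shift) simp
  also have "\<dots> = (\<Sum>n\<le>?N. conv ?D (\<lambda>u. \<iota> (1 / of_nat (fact n)) * cpow d n u) u)"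
    unfolding cpow_add_xgen mult.assoc[symmetric] C_algebra_hom_inverse_fact_Suc[OF \<iota>]
      conv_mult_right ..
  also have "\<dots> = conv ?D (\<lambda>u. \<Sum>n\<le>?N. \<iota> (1 / of_nat (fact n)) * cpow d n u) u"
    by (rule conv_sum_right[symmetric])
  also have "\<dots> = conv ?D (cexp \<iota> d) u"
    by (intro conv_cong_bdeg cexp_eq_sum[symmetric] d)
  finally show "cexp \<iota> d (u + xgen m) = conv ?D (cexp \<iota> d) u" .
qed

subsection \<open>Convolution operators\<close>

definition conv_op :: "('k bas \<Rightarrow> 'a::comm_ring_1) \<Rightarrow> ('k bas \<Rightarrow>\<^sub>0 'a) \<Rightarrow> ('k bas \<Rightarrow>\<^sub>0 'a)" where
  "conv_op d = lin_ext (\<lambda>u. cop_sum (\<lambda>a b. smul (d a) (bv b)) u)"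

lemma A_linear_conv_op: "A_linear (conv_op d)"
  unfolding conv_op_def by (rule A_linear_lin_ext)

lemma conv_op_bv: "conv_op d (bv u) = cop_sum (\<lambda>a b. smul (d a) (bv b)) u"
  by (simp add: conv_op_def)

lemma A_linear_comp: "A_linear L \<Longrightarrow> A_linear M \<Longrightarrow> A_linear (\<lambda>f. L (M f))"
  by (simp add: A_linear_def)

lemma A_linear_sum_fun:
  assumes "\<And>i. i \<in> I \<Longrightarrow> A_linear (L i)"
  shows "A_linear (\<lambda>f. \<Sum>i\<in>I. L i f)"
  using assms by (intro A_linearI) (simp_all add: A_linear_def sum.distrib smul_sum_right)

lemma A_linear_smul_fun: "A_linear L \<Longrightarrow> A_linear (\<lambda>f. smul s (L f))"
  by (simp add: A_linear_def smul_add_right smul_smul mult.commute)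

lemma conv_op_conv_op: "conv_op d (conv_op e f) = conv_op (conv e d) f"
proof (rule A_linear_eqI[where f = f])
  fix u
  have "conv_op d (conv_op e (bv u))
      = cop_sum (\<lambda>a b. cop_sum (\<lambda>p q. smul (e a * d p) (bv q)) b) u"
    by (simp add: conv_op_bv cop_sum_linear[OF A_linear_conv_op] A_linear_smul[OF A_linear_conv_op]
        smul_cop_sum_right smul_smul)
  also have "\<dots> = cop_sum (\<lambda>a b. cop_sum (\<lambda>p q. smul (e p * d q) (bv b)) a) u"
    by (rule cop_sum_assoc[symmetric])
  also have "\<dots> = conv_op (conv e d) (bv u)"
    by (simp add: conv_op_bv conv_def smul_cop_sum_left)
  finally show "conv_op d (conv_op e (bv u)) = conv_op (conv e d) (bv u)" .
qed (rule A_linear_comp[OF A_linear_conv_op A_linear_conv_op] A_linear_conv_op)+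

lemma conv_op_counit: "conv_op counit f = f"
proof (rule A_linear_eqI[where f = f])
  fix u show "conv_op counit (bv u) = bv u"
    unfolding conv_op_bv by (subst cop_sum_group_left) (auto simp: counit_def)
qed (rule A_linear_conv_op, simp add: A_linear_def)

lemma conv_op_sum: "conv_op (\<lambda>u. \<Sum>i\<in>I. d i u) f = (\<Sum>i\<in>I. conv_op (d i) f)"
  by (rule A_linear_eqI[where f = f])
     (auto intro!: A_linear_conv_op A_linear_sum_fun simp: conv_op_bv smul_sum_left cop_sum_sum)

lemma conv_op_smul: "conv_op (\<lambda>u. s * d u) f = smul s (conv_op d f)"
  by (rule A_linear_eqI[where f = f])
     (auto intro!: A_linear_conv_op A_linear_smul_fun simp: conv_op_bv smul_cop_sum_right smul_smul)

lemma conv_op_funpow: "(conv_op d ^^ n) f = conv_op (cpow d n) f"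
  by (induction n) (simp_all add: conv_op_counit conv_op_conv_op conv_commute)

lemma bdeg_le_xdeg:
  assumes "u \<in> Poly_Mapping.keys f"
  shows "bdeg u \<le> xdeg f"
  unfolding xdeg_def by (rule Max_ge) (use assms in auto)

lemma conv_op_cong_bdeg:
  assumes "\<And>w. bdeg w \<le> xdeg f \<Longrightarrow> d w = e w"
  shows "conv_op d f = conv_op e f"
  unfolding conv_op_def lin_ext_def
proof (rule sum.cong)
  fix u assume u: "u \<in> Poly_Mapping.keys f"
  have "cop_sum (\<lambda>a b. smul (d a) (bv b)) u = cop_sum (\<lambda>a b. smul (e a) (bv b)) u"
  proof (rule cop_sum_cong)
    fix \<nu> assume "\<nu> \<in> divs (snd u)"
    then have "mdeg \<nu> \<le> xdeg f" using bdeg_le_xdeg[OF u] mdeg_mono by (metis le_trans)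
    then show "smul (d (fst u, \<nu>)) (bv (fst u, snd u - \<nu>)) = smul (e (fst u, \<nu>)) (bv (fst u, snd u - \<nu>))"
      by (simp add: assms)
  qed
  then show "smul (Poly_Mapping.lookup f u) (cop_sum (\<lambda>a b. smul (d a) (bv b)) u)
      = smul (Poly_Mapping.lookup f u) (cop_sum (\<lambda>a b. smul (e a) (bv b)) u)"
    by simp
qed simp

text \<open>\<open>expop\<close> cuts at \<open>xdeg f\<close>, which bounds the degree of every leg
  that occurs, so on each leg it computes the same sum as \<open>cexp\<close>.\<close>

lemma expop_conv_op:
  assumes d: "\<And>\<alpha>. d (\<alpha>, 0) = 0"
  shows "expop \<iota> (conv_op d) f = conv_op (cexp \<iota> d) f"
proof -
  have "expop \<iota> (conv_op d) f
      = conv_op (\<lambda>u. \<Sum>n\<le>xdeg f. \<iota> (1 / of_nat (fact n)) * cpow d n u) f"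
    unfolding expop_def conv_op_sum conv_op_smul conv_op_funpow ..
  also have "\<dots> = conv_op (cexp \<iota> d) f"
    by (intro conv_op_cong_bdeg cexp_eq_sum[symmetric] d)
  finally show ?thesis .
qed

text \<open>The infinite sums over the variables are finite on each basis element, hence still
  convolution operators.\<close>

lemma conv_op_local_sum:
  assumes "\<And>u. finite (K u)" "\<And>u i. i \<notin> K u \<Longrightarrow> e i u = 0"
    and "\<And>\<alpha> \<mu> \<nu>. \<nu> \<in> divs \<mu> \<Longrightarrow> K (\<alpha>, \<nu>) \<subseteq> K (\<alpha>, \<mu>)"
  shows "conv_op (\<lambda>u. \<Sum>i\<in>K u. e i u) (bv u) = (\<Sum>i\<in>K u. conv_op (e i) (bv u))"
proof -
  have "conv_op (\<lambda>u. \<Sum>i\<in>K u. e i u) (bv u) = cop_sum (\<lambda>a b. smul (\<Sum>i\<in>K u. e i a) (bv b)) u"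
    unfolding conv_op_bv
  proof (rule cop_sum_cong)
    fix \<nu> assume \<nu>: "\<nu> \<in> divs (snd u)"
    \<comment> \<open>Enlarging the index set of the leg to that of \<open>u\<close> adds only zeros
      and makes it independent of the leg.\<close>
    have "(\<Sum>i\<in>K (fst u, \<nu>). e i (fst u, \<nu>)) = (\<Sum>i\<in>K u. e i (fst u, \<nu>))"
      using assms(3)[OF \<nu>, of "fst u"] by (intro sum.mono_neutral_left) (auto simp: assms(1,2))
    then show "smul (\<Sum>i\<in>K (fst u, \<nu>). e i (fst u, \<nu>)) (bv (fst u, snd u - \<nu>))
        = smul (\<Sum>i\<in>K u. e i (fst u, \<nu>)) (bv (fst u, snd u - \<nu>))" by simp
  qed
  then show ?thesis by (simp add: conv_op_bv smul_sum_left cop_sum_sum)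
qed

section \<open>The derivations and the summands of Q as convolution operators\<close>

definition alpha_fun :: "'k \<Rightarrow> 'k bas \<Rightarrow> 'a::comm_ring_1" where
  "alpha_fun i u = counit u * of_int (fst u i)"

text \<open>The value is 1 on e^\<alpha> x_m for every \<alpha>, since the derivation with respect
  to x_m ignores the group part.\<close>

definition x_fun :: "nat \<Rightarrow> 'k bas \<Rightarrow> 'a::comm_ring_1" where
  "x_fun m u = (if snd u = Poly_Mapping.single m 1 then 1 else 0)"

lemma x_fun_add_xgen: "x_fun m (u + xgen p) = (if m = p then counit u else 0)"
proof -
  have "m = p \<and> snd u = 0" if "snd u + Poly_Mapping.single p 1 = Poly_Mapping.single m 1"
  proof -
    have "m = p"
      using arg_cong[OF that, of "\<lambda>\<mu>. Poly_Mapping.lookup \<mu> p"]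
      by (auto simp: lookup_add lookup_single when_def split: if_splits)
    with that show ?thesis by (simp del: One_nat_def)
  qed
  then show ?thesis by (auto simp: x_fun_def counit_def simp del: One_nat_def)
qed

lemma x_fun_notin_keys: "m \<notin> Poly_Mapping.keys (snd u) \<Longrightarrow> x_fun m u = 0"
  by (auto simp: x_fun_def)

lemma conv_x_fun_notin_keys:
  assumes "m \<notin> Poly_Mapping.keys (snd u)"
  shows "conv (x_fun m) e u = 0"
proof -
  have "conv (x_fun m) e u = cop_sum (\<lambda>a b. 0) u"
    unfolding conv_def
  proof (rule cop_sum_cong)
    fix \<nu> assume "\<nu> \<in> divs (snd u)"
    with assms have "m \<notin> Poly_Mapping.keys \<nu>" using keys_divs by blast
    then show "x_fun m (fst u, \<nu>) * e (fst u, snd u - \<nu>) = 0"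
      by (simp add: x_fun_notin_keys)
  qed
  then show ?thesis by simp
qed

lemma d_alpha_eq_conv_op: "d_alpha i = (conv_op (alpha_fun i) :: ('k bas \<Rightarrow>\<^sub>0 'a::comm_ring_1) \<Rightarrow> _)"
proof
  fix f :: "'k bas \<Rightarrow>\<^sub>0 'a"
  show "d_alpha i f = conv_op (alpha_fun i) f"
  proof (rule A_linear_eqI[where f = f])
    fix u :: "'k bas"
    have "conv_op (alpha_fun i) (bv u) = smul (alpha_fun i (fst u, 0)) (bv u :: _ \<Rightarrow>\<^sub>0 'a)"
      unfolding conv_op_bv by (rule cop_sum_group_left) (auto simp: alpha_fun_def counit_def)
    then show "d_alpha i (bv u) = conv_op (alpha_fun i) (bv u :: _ \<Rightarrow>\<^sub>0 'a)"
      by (cases u) (simp add: d_alpha_def alpha_fun_def smul_bv)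
  qed (auto simp: d_alpha_def A_linear_lin_ext A_linear_conv_op)
qed

lemma mbinom_single:
  assumes "m \<in> Poly_Mapping.keys \<mu>"
  shows "mbinom \<mu> (Poly_Mapping.single m 1) = Poly_Mapping.lookup \<mu> m"
proof -
  have "mbinom \<mu> (Poly_Mapping.single m 1)
      = (\<Prod>n\<in>Poly_Mapping.keys \<mu>. if n = m then Poly_Mapping.lookup \<mu> m else 1)"
    unfolding mbinom_def by (intro prod.cong) (auto simp: lookup_single when_def)
  with assms show ?thesis by simp
qed

text \<open>The functional selects the left leg with monomial x_m, whose multiplicity in the
  coproduct is the exponent of x_m, the factor produced by differentiation.\<close>

lemma d_x_eq_conv_op: "d_x m = (conv_op (x_fun m) :: ('k bas \<Rightarrow>\<^sub>0 'a::comm_ring_1) \<Rightarrow> _)"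
proof
  fix f :: "'k bas \<Rightarrow>\<^sub>0 'a"
  show "d_x m f = conv_op (x_fun m) f"
  proof (rule A_linear_eqI[where f = f])
    fix u :: "'k bas"
    obtain \<alpha> \<mu> where u: "u = (\<alpha>, \<mu>)" by (cases u)
    let ?e = "Poly_Mapping.single m 1 :: nat \<Rightarrow>\<^sub>0 nat"
    have "conv_op (x_fun m) (bv u)
        = (\<Sum>\<nu>\<in>divs \<mu>. of_nat (mbinom \<mu> \<nu>) * smul (x_fun m (\<alpha>, \<nu>)) (bv (\<alpha>, \<mu> - \<nu>) :: _ \<Rightarrow>\<^sub>0 'a))"
      by (simp add: conv_op_bv cop_sum_def u)
    also have "\<dots> = (\<Sum>\<nu>\<in>divs \<mu> \<inter> {?e}. of_nat (mbinom \<mu> \<nu>) * smul (x_fun m (\<alpha>, \<nu>)) (bv (\<alpha>, \<mu> - \<nu>)))"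
      by (rule sum.mono_neutral_right) (auto simp: x_fun_def)
    also have "\<dots> = d_x m (bv u)"
    proof (cases "Poly_Mapping.lookup \<mu> m = 0")
      case True
      then have "?e \<notin> divs \<mu>" by (auto simp: divs_iff lookup_single intro!: exI[of _ m])
      with True show ?thesis by (simp add: u d_x_def del: One_nat_def)
    next
      case False
      then have "?e \<in> divs \<mu>" by (auto simp: divs_iff lookup_single when_def)
      moreover have "mbinom \<mu> ?e = Poly_Mapping.lookup \<mu> m"
        using False by (intro mbinom_single) (simp add: in_keys_iff)
      ultimately show ?thesis using False
        by (simp add: u d_x_def x_fun_def smul_bv smul_single flip: smul_of_nat del: One_nat_def)
    qed
    finally show "d_x m (bv u) = conv_op (x_fun m) (bv u :: _ \<Rightarrow>\<^sub>0 'a)" ..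
  qed (auto simp: d_x_def A_linear_lin_ext A_linear_conv_op)
qed

text \<open>Composition of derivations becomes convolution of functionals. Variables that do not
  occur in \<open>u\<close> would contribute 0, by \<open>conv_x_fun_notin_keys\<close>.\<close>

definition Qb_fun :: "('k::finite \<Rightarrow> nat \<Rightarrow> 'a::comm_ring_1) \<Rightarrow> 'k bas \<Rightarrow> 'a" where
  "Qb_fun b u = (\<Sum>(i, m)\<in>UNIV \<times> Poly_Mapping.keys (snd u). b i m * conv (x_fun m) (alpha_fun i) u)"

definition Qq_fun :: "(nat \<Rightarrow> nat \<Rightarrow> 'a::comm_ring_1) \<Rightarrow> 'k bas \<Rightarrow> 'a" where
  "Qq_fun q u = (\<Sum>(m, n)\<in>Poly_Mapping.keys (snd u) \<times> Poly_Mapping.keys (snd u).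
     q m n * conv (x_fun m) (x_fun n) u)"

lemma Q_b_eq_conv_op: "Q_b b = (conv_op (Qb_fun b) :: ('k::finite bas \<Rightarrow>\<^sub>0 'a::comm_ring_1) \<Rightarrow> _)"
proof
  fix f :: "'k bas \<Rightarrow>\<^sub>0 'a"
  show "Q_b b f = conv_op (Qb_fun b) f"
  proof (rule A_linear_eqI[where f = f])
    fix u :: "'k bas"
    have "conv_op (Qb_fun b) (bv u) = (\<Sum>p\<in>UNIV \<times> Poly_Mapping.keys (snd u).
       conv_op (\<lambda>u. b (fst p) (snd p) * conv (x_fun (snd p)) (alpha_fun (fst p)) u) (bv u))"
      unfolding Qb_fun_def case_prod_beta
    proof (rule conv_op_local_sum)
      fix w :: "'k bas" and p assume "p \<notin> (UNIV :: 'k set) \<times> Poly_Mapping.keys (snd w)"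
      then show "b (fst p) (snd p) * conv (x_fun (snd p)) (alpha_fun (fst p)) w = 0"
        by (simp add: mem_Times_iff conv_x_fun_notin_keys)
    qed (auto dest: keys_divs)
    then show "Q_b b (bv u) = conv_op (Qb_fun b) (bv u)"
      by (cases u)
        (simp add: Q_b_def d_alpha_eq_conv_op d_x_eq_conv_op conv_op_conv_op conv_op_smul
          sum.cartesian_product case_prod_beta)
  qed (auto simp: Q_b_def A_linear_lin_ext A_linear_conv_op)
qed

text \<open>The derivations commute, so the third summand of Q is the second with transposed
  coefficients.\<close>

lemma Q_c_eq_conv_op: "Q_c c = (conv_op (Qb_fun (\<lambda>i m. c m i)) :: ('k::finite bas \<Rightarrow>\<^sub>0 'a::comm_ring_1) \<Rightarrow> _)"
proof -
  have "Q_c c = Q_b (\<lambda>i m. c m i)"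
    unfolding Q_c_def Q_b_def d_alpha_eq_conv_op d_x_eq_conv_op conv_op_conv_op
    by (subst sum.swap) (simp add: conv_commute)
  then show ?thesis by (simp add: Q_b_eq_conv_op)
qed

lemma Q_q_eq_conv_op: "Q_q q = (conv_op (Qq_fun q) :: ('k::finite bas \<Rightarrow>\<^sub>0 'a::comm_ring_1) \<Rightarrow> _)"
proof
  fix f :: "'k bas \<Rightarrow>\<^sub>0 'a"
  show "Q_q q f = conv_op (Qq_fun q) f"
  proof (rule A_linear_eqI[where f = f])
    fix u :: "'k bas"
    have z: "conv (x_fun m) (x_fun n) w = 0"
      if "m \<notin> Poly_Mapping.keys (snd w) \<or> n \<notin> Poly_Mapping.keys (snd w)" for m n and w :: "'k bas"
      using that conv_x_fun_notin_keys by (metis conv_commute)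
    have "conv_op (Qq_fun q) (bv u) = (\<Sum>p\<in>Poly_Mapping.keys (snd u) \<times> Poly_Mapping.keys (snd u).
       conv_op (\<lambda>u. q (fst p) (snd p) * conv (x_fun (fst p)) (x_fun (snd p)) u) (bv u))"
      unfolding Qq_fun_def case_prod_beta
    proof (rule conv_op_local_sum)
      fix w :: "'k bas" and p assume "p \<notin> Poly_Mapping.keys (snd w) \<times> Poly_Mapping.keys (snd w)"
      then show "q (fst p) (snd p) * conv (x_fun (fst p)) (x_fun (snd p)) w = 0"
        by (simp add: mem_Times_iff z)
    qed (auto dest: keys_divs)
    then show "Q_q q (bv u) = conv_op (Qq_fun q) (bv u)"
      by (cases u)
        (simp add: Q_q_def d_x_eq_conv_op conv_op_conv_op conv_op_smul
          sum.cartesian_product case_prod_beta conv_commute)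
  qed (auto simp: Q_q_def A_linear_lin_ext A_linear_conv_op)
qed

text \<open>The first summand of Q preserves the degree, so its exponential does not terminate and
  enters in closed form, supported on grouplike elements.\<close>

definition Qa_fun :: "(complex \<Rightarrow> 'a::comm_ring_1) \<Rightarrow> ('k::finite \<Rightarrow> 'k \<Rightarrow> complex) \<Rightarrow> 'k bas \<Rightarrow> 'a" where
  "Qa_fun \<iota> a u = counit u *
     \<iota> (exp (\<Sum>i\<in>UNIV. \<Sum>j\<in>UNIV. a i j * of_int (fst u i) * of_int (fst u j)))"

lemma exp_Qa_eq_conv_op: "exp_Qa \<iota> a = (conv_op (Qa_fun \<iota> a) :: ('k::finite bas \<Rightarrow>\<^sub>0 'a::comm_ring_1) \<Rightarrow> _)"
proof
  fix f :: "'k bas \<Rightarrow>\<^sub>0 'a"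
  show "exp_Qa \<iota> a f = conv_op (Qa_fun \<iota> a) f"
  proof (rule A_linear_eqI[where f = f])
    fix u :: "'k bas"
    have "conv_op (Qa_fun \<iota> a) (bv u) = smul (Qa_fun \<iota> a (fst u, 0)) (bv u)"
      unfolding conv_op_bv by (rule cop_sum_group_left) (auto simp: Qa_fun_def counit_def)
    then show "exp_Qa \<iota> a (bv u) = conv_op (Qa_fun \<iota> a) (bv u)"
      by (cases u) (simp add: exp_Qa_def Qa_fun_def smul_bv)
  qed (auto simp: exp_Qa_def A_linear_lin_ext A_linear_conv_op)
qed

section \<open>Derivatives of these functionals in the directions x_p\<close>

lemma Qb_fun_group [simp]: "Qb_fun b (\<alpha>, 0) = 0"
  by (simp add: Qb_fun_def)

lemma Qq_fun_group [simp]: "Qq_fun q (\<alpha>, 0) = 0"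
  by (simp add: Qq_fun_def)

lemma alpha_fun_add_xgen [simp]: "alpha_fun i (u + xgen m) = 0"
  by (simp add: alpha_fun_def)

text \<open>The direction x_p annihilates \<open>alpha_fun i\<close> and turns
  \<open>x_fun m\<close> into the convolution unit if m = p, so a primitive functional
  remains.\<close>

lemma Qb_fun_add_xgen: "Qb_fun b (u + xgen p) = (\<Sum>i\<in>UNIV. b i p * alpha_fun i u)"
proof -
  have "Qb_fun b (u + xgen p) = (\<Sum>i\<in>UNIV. \<Sum>m\<in>insert p (Poly_Mapping.keys (snd u)).
      if m = p then b i p * alpha_fun i u else 0)"
    unfolding Qb_fun_def sum.cartesian_product[symmetric]
    by (intro sum.cong)
       (auto simp: conv_add_xgen x_fun_add_xgen keys_add_single_1 simp del: One_nat_def)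
  then show ?thesis by (simp add: sum.delta del: sum.insert)
qed

text \<open>Either of the two factors can absorb the direction x_p, whence the symmetrized
  coefficient.\<close>

lemma Qq_fun_add_xgen:
  "Qq_fun q (u + xgen p) = (\<Sum>n\<in>Poly_Mapping.keys (snd u). (q p n + q n p) * x_fun n u)"
proof -
  let ?K = "insert p (Poly_Mapping.keys (snd u))"
  have "Qq_fun q (u + xgen p) = (\<Sum>m\<in>?K. \<Sum>n\<in>?K.
      (if m = p then q p n * x_fun n u else 0) + (if n = p then q m p * x_fun m u else 0))"
    unfolding Qq_fun_def sum.cartesian_product[symmetric]
    by (intro sum.cong)
       (auto simp: conv_add_xgen x_fun_add_xgen keys_add_single_1 algebra_simps simp del: One_nat_def)
  also have "\<dots> = (\<Sum>n\<in>?K. \<Sum>m\<in>?K. if m = p then q p n * x_fun n u else 0)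
      + (\<Sum>m\<in>?K. \<Sum>n\<in>?K. if n = p then q m p * x_fun m u else 0)"
    unfolding sum.distrib by (subst sum.swap) (rule refl)
  also have "\<dots> = (\<Sum>n\<in>?K. (q p n + q n p) * x_fun n u)"
    by (simp add: sum.delta sum.distrib algebra_simps del: sum.insert)
  also have "\<dots> = (\<Sum>n\<in>Poly_Mapping.keys (snd u). (q p n + q n p) * x_fun n u)"
    by (rule sum.mono_neutral_right) (auto simp: x_fun_notin_keys)
  finally show ?thesis .
qed

lemma logderiv_Qa_fun: "logderiv (\<lambda>m u. 0) (Qa_fun \<iota> a)"
  by (simp add: logderiv_def Qa_fun_def)

subsection \<open>Bicharacters in terms of basis elements\<close>

definition sym_fun :: "('k bas \<Rightarrow> 'k bas \<Rightarrow> 'a::comm_ring_1) \<Rightarrow> 'k bas \<Rightarrow> 'k bas \<Rightarrow> 'a" where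
  "sym_fun r u v = cop_sum (\<lambda>a b. cop_sum (\<lambda>c d. r a c * r d b) v) u"

lemma cop_sum_mult_cop_sum:
  "cop_sum F u * cop_sum G v = cop_sum (\<lambda>a b. cop_sum (\<lambda>c d. F a b * G c d) v) u"
  by (simp add: cop_sum_mult_left cop_sum_mult_right)

locale basis_bicharacter =
  fixes r :: "'k::finite bas \<Rightarrow> 'k bas \<Rightarrow> 'a::comm_ring_1"
  assumes zero_left: "r 0 v = counit v"
    and zero_right: "r v 0 = counit v"
    and plus_left: "r (u + v) w = cop_sum (\<lambda>a b. r u a * r v b) w"
    and plus_right: "r w (u + v) = cop_sum (\<lambda>a b. r a u * r b v) w"
begin

text \<open>Both sides are sums over the fourfold coproducts of \<open>u\<close> and \<open>v\<close> of
  products of four values of \<open>r\<close>.\<close>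

lemma cop_sum_diag_plus:
  "cop_sum r (u + v) = cop_sum (\<lambda>a b. cop_sum (\<lambda>c d. cop_sum r a * cop_sum r c * sym_fun r b d) v) u"
proof -
  \<comment> \<open>The legs of \<open>u\<close> are e, f, a, b and those of \<open>v\<close> are g,
    h, c, d. In the target, r(e, a) belongs to R(u'), r(h, d) to R(v'), and r(f, c) r(g, b) to s(u''
    \<otimes> v''). What follows brings the legs into this grouping.\<close>
  define Y where "Y e f a b g h c d = r e a * r f c * (r g b * r h d)" for e f a b g h c d
  have mul: "r (u1 + v1) (u2 + v2) = cop_sum (\<lambda>a b. cop_sum (\<lambda>c d. cop_sum (\<lambda>e f. cop_sum (\<lambda>g h.
      Y e f a b g h c d) v1) u1) v2) u2" for u1 v1 u2 v2
  proof -
    have "r (u1 + v1) (u2 + v2) = cop_sum (\<lambda>a b. cop_sum (\<lambda>c d. r u1 (a + c) * r v1 (b + d)) v2) u2"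
      unfolding plus_left[of u1 v1] by (rule cop_sum_plus)
    then show ?thesis unfolding plus_right cop_sum_mult_cop_sum Y_def .
  qed
  have "cop_sum r (u + v) = cop_sum (\<lambda>u1 u2. cop_sum (\<lambda>v1 v2. r (u1 + v1) (u2 + v2)) v) u"
    by (rule cop_sum_plus)
  also have "\<dots> = cop_sum4 (\<lambda>e f a b. cop_sum4 (\<lambda>g h c d. Y e f a b g h c d) v) u"
  proof -
    have "cop_sum (\<lambda>v1 v2. r (u1 + v1) (u2 + v2)) v
        = cop_sum (\<lambda>e f. cop_sum (\<lambda>a b. cop_sum4 (\<lambda>g h c d. Y e f a b g h c d) v) u2) u1" for u1 u2
    proof -
      have 1: "cop_sum (\<lambda>c d. cop_sum (\<lambda>e f. cop_sum (\<lambda>g h. Y e f a b g h c d) v1) u1) v2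
          = cop_sum (\<lambda>e f. cop_sum (\<lambda>g h. cop_sum (\<lambda>c d. Y e f a b g h c d) v2) v1) u1" for a b v1 v2
        by (subst cop_sum_commute, subst (2) cop_sum_commute) (rule refl)
      have "cop_sum (\<lambda>v1 v2. r (u1 + v1) (u2 + v2)) v = cop_sum (\<lambda>v1 v2.
          cop_sum (\<lambda>a b. cop_sum (\<lambda>e f. cop_sum (\<lambda>g h. cop_sum (\<lambda>c d. Y e f a b g h c d) v2) v1) u1) u2) v"
        unfolding mul 1 ..
      also have "\<dots> = cop_sum (\<lambda>a b. cop_sum (\<lambda>v1 v2.
          cop_sum (\<lambda>e f. cop_sum (\<lambda>g h. cop_sum (\<lambda>c d. Y e f a b g h c d) v2) v1) u1) v) u2"
        by (rule cop_sum_commute)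
      also have "\<dots> = cop_sum (\<lambda>a b. cop_sum (\<lambda>e f. cop_sum4 (\<lambda>g h c d. Y e f a b g h c d) v) u1) u2"
        unfolding cop_sum4_def by (subst cop_sum_commute) (rule refl)
      also have "\<dots> = cop_sum (\<lambda>e f. cop_sum (\<lambda>a b. cop_sum4 (\<lambda>g h c d. Y e f a b g h c d) v) u2) u1"
        by (rule cop_sum_commute)
      finally show ?thesis .
    qed
    then show ?thesis unfolding cop_sum4_def[of _ u] by simp
  qed
  \<comment> \<open>Pairs e with a and f with b in the coproduct of \<open>u\<close>.\<close>
  also have "\<dots> = cop_sum4 (\<lambda>e a f b. cop_sum4 (\<lambda>g h c d. Y e f a b g h c d) v) u"
    by (rule cop_sum4_swap_mid)
  \<comment> \<open>Pairs h with d, and puts c before g, the order in which \<open>sym_fun\<close>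
    reads the legs of its second argument.\<close>
  also have "\<dots> = cop_sum4 (\<lambda>e a f b. cop_sum4 (\<lambda>h d c g. Y e f a b g h c d) v) u"
    by (rule arg_cong[where f = "\<lambda>F. cop_sum4 F u"]) (intro ext cop_sum4_rotate)
  also have "\<dots> = cop_sum (\<lambda>u1 u2. cop_sum (\<lambda>v1 v2. cop_sum r u1 * cop_sum r v1 * sym_fun r u2 v2) v) u"
  proof -
    have "cop_sum (\<lambda>v1 v2. cop_sum r u1 * cop_sum r v1 * sym_fun r u2 v2) v
       = cop_sum (\<lambda>e a. cop_sum (\<lambda>f b. cop_sum4 (\<lambda>h d c g. Y e f a b g h c d) v) u2) u1" for u1 u2
    proof -
      have 1: "cop_sum r u1 * cop_sum r v1 * sym_fun r u2 v2 = cop_sum (\<lambda>e a. cop_sum (\<lambda>f b.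
          cop_sum (\<lambda>h d. cop_sum (\<lambda>c g. Y e f a b g h c d) v2) v1) u2) u1" for v1 v2
      proof -
        have "cop_sum r u1 * cop_sum r v1 * sym_fun r u2 v2 = cop_sum r u1 * (sym_fun r u2 v2 * cop_sum r v1)"
          by (simp add: mult_ac)
        also have "sym_fun r u2 v2 * cop_sum r v1 = cop_sum (\<lambda>f b. cop_sum (\<lambda>c g. cop_sum (\<lambda>h d.
            r f c * r g b * r h d) v1) v2) u2"
          unfolding sym_fun_def
          by (simp only: cop_sum_mult_right[symmetric], simp only: cop_sum_mult_left[symmetric])
        also have "\<dots> = cop_sum (\<lambda>f b. cop_sum (\<lambda>h d. cop_sum (\<lambda>c g. r f c * r g b * r h d) v2) v1) u2"
          by (subst (2) cop_sum_commute) (rule refl)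
        also have "cop_sum r u1 * \<dots> = cop_sum (\<lambda>e a. cop_sum (\<lambda>f b. cop_sum (\<lambda>h d. cop_sum (\<lambda>c g.
            r e a * (r f c * r g b * r h d)) v2) v1) u2) u1"
          by (simp only: cop_sum_mult_right[symmetric], simp only: cop_sum_mult_left[symmetric])
        finally show ?thesis by (simp add: Y_def mult_ac)
      qed
      have "cop_sum (\<lambda>v1 v2. cop_sum r u1 * cop_sum r v1 * sym_fun r u2 v2) v =
          cop_sum (\<lambda>e a. cop_sum (\<lambda>v1 v2. cop_sum (\<lambda>f b.
          cop_sum (\<lambda>h d. cop_sum (\<lambda>c g. Y e f a b g h c d) v2) v1) u2) v) u1"
        unfolding 1 by (rule cop_sum_commute)
      also have "\<dots> = cop_sum (\<lambda>e a. cop_sum (\<lambda>f b. cop_sum4 (\<lambda>h d c g. Y e f a b g h c d) v) u2) u1"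
        unfolding cop_sum4_def by (subst (2) cop_sum_commute) (rule refl)
      finally show ?thesis .
    qed
    then show ?thesis unfolding cop_sum4_def[of _ u] by simp
  qed
  finally show ?thesis .
qed

lemma primitive_left: "r (xgen p) (u + v) = r (xgen p) u * counit v + counit u * r (xgen p) v"
  by (simp add: plus_right cop_sum_xgen zero_left)

lemma primitive_right: "r (u + v) (xgen p) = r u (xgen p) * counit v + counit u * r v (xgen p)"
  by (simp add: plus_left cop_sum_xgen zero_right)

text \<open>Since R(x_m) = 0 and R(1) = 1, the only surviving term has x_m inside s, and primitivity
  of x_m splits s(. \<otimes> x_m) into the contributions of r and of its transpose.\<close>

lemma logderiv_diag: "logderiv (\<lambda>m u. r u (xgen m) + r (xgen m) u) (cop_sum r)"
  unfolding logderiv_def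
proof (intro allI)
  fix u m
  have sym0: "sym_fun r u 0 = counit u" for u
  proof -
    have "sym_fun r u 0 = conv counit counit u"
      by (simp add: sym_fun_def conv_def zero_left zero_right)
    then show ?thesis by simp
  qed
  have symx: "sym_fun r u (xgen m) = r u (xgen m) + r (xgen m) u" for u
  proof -
    have "sym_fun r u (xgen m) = conv (\<lambda>a. r a (xgen m)) counit u + conv counit (r (xgen m)) u"
      by (simp add: sym_fun_def conv_def zero_left zero_right cop_sum_xgen cop_sum_add)
    then show ?thesis by simp
  qed
  have "cop_sum r (u + xgen m) = conv (cop_sum r) (\<lambda>u. r u (xgen m) + r (xgen m) u) u"
    by (simp add: cop_sum_diag_plus cop_sum_xgen zero_left zero_right sym0 symx conv_def)
  then show "cop_sum r (u + xgen m) = conv (\<lambda>u. r u (xgen m) + r (xgen m) u) (cop_sum r) u"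
    by (simp add: conv_commute)
qed

lemma diag_zero [simp]: "cop_sum r 0 = 1"
  by (simp add: zero_left)

lemma diag_xgen [simp]: "cop_sum r (xgen m) = 0"
  by (simp add: cop_sum_xgen zero_left zero_right)

lemma conv_op_diag_one: "conv_op (cop_sum r) 1 = 1"
  unfolding bv_zero[symmetric] conv_op_bv cop_sum_zero_bas[of "\<lambda>a b. smul (cop_sum r a) (bv b)"]
  by (simp only: diag_zero smul_one)

lemma group_left: "r (\<alpha> + \<alpha>', 0) (\<beta>, 0) = r (\<alpha>, 0) (\<beta>, 0) * r (\<alpha>', 0) (\<beta>, 0)"
  using plus_left[of "(\<alpha>, 0)" "(\<alpha>', 0)" "(\<beta>, 0)"] by simp

lemma group_right: "r (\<beta>, 0) (\<alpha> + \<alpha>', 0) = r (\<beta>, 0) (\<alpha>, 0) * r (\<beta>, 0) (\<alpha>', 0)"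
  using plus_right[of "(\<beta>, 0)" "(\<alpha>, 0)" "(\<alpha>', 0)"] by simp

end

subsection \<open>Characters and primitive functionals\<close>

text \<open>Moving a nonzero coordinate one step towards 0 lowers the sum of absolute values;
  integer exponents call for steps of both signs.\<close>

lemma group_induct [case_names zero plus minus]:
  fixes \<alpha> :: "'k::finite \<Rightarrow> int"
  assumes zero: "P 0" and plus: "\<And>\<alpha> i. P \<alpha> \<Longrightarrow> P (\<alpha> + alpha_gen i)"
    and minus: "\<And>\<alpha> i. P \<alpha> \<Longrightarrow> P (\<alpha> - alpha_gen i)"
  shows "P \<alpha>"
proof (induction "\<Sum>i\<in>UNIV. nat \<bar>\<alpha> i\<bar>" arbitrary: \<alpha> rule: less_induct)
  case less
  show ?case
  proof (cases "\<alpha> = 0")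
    case False
    then obtain i where i: "\<alpha> i \<noteq> 0" by (auto simp: fun_eq_iff)
    define \<beta> where "\<beta> = (if \<alpha> i > 0 then \<alpha> - alpha_gen i else \<alpha> + alpha_gen i)"
    have "(\<Sum>j\<in>UNIV. nat \<bar>\<beta> j\<bar>) < (\<Sum>j\<in>UNIV. nat \<bar>\<alpha> j\<bar>)"
      using i by (intro sum_strict_mono_ex1) (auto simp: \<beta>_def alpha_gen_def intro!: bexI[of _ i])
    then have "P \<beta>" by (rule less)
    moreover have "\<alpha> = (if \<alpha> i > 0 then \<beta> + alpha_gen i else \<beta> - alpha_gen i)"
      by (auto simp: \<beta>_def)
    ultimately show ?thesis using plus minus by metis
  qed (use zero in simp)
qed

lemma sum_add_alpha_gen:
  fixes z :: "'k::finite \<Rightarrow> 'b::comm_ring_1"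
  shows "(\<Sum>j\<in>UNIV. z j * of_int ((\<alpha> + alpha_gen i) j)) = (\<Sum>j\<in>UNIV. z j * of_int (\<alpha> j)) + z i"
    and "(\<Sum>j\<in>UNIV. z j * of_int ((\<alpha> - alpha_gen i) j)) = (\<Sum>j\<in>UNIV. z j * of_int (\<alpha> j)) - z i"
proof -
  have "(\<Sum>j\<in>UNIV. z j * of_int (alpha_gen i j)) = z i"
    by (simp add: alpha_gen_def if_distrib cong: if_cong)
  then show "(\<Sum>j\<in>UNIV. z j * of_int ((\<alpha> + alpha_gen i) j)) = (\<Sum>j\<in>UNIV. z j * of_int (\<alpha> j)) + z i"
    and "(\<Sum>j\<in>UNIV. z j * of_int ((\<alpha> - alpha_gen i) j)) = (\<Sum>j\<in>UNIV. z j * of_int (\<alpha> j)) - z i"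
    by (simp_all add: distrib_left right_diff_distrib sum.distrib sum_subtractf)
qed

text \<open>Steps along \<open>alpha_gen i\<close> multiply by a known factor. Downward steps are
  possible because this factor is a unit: exp(z) exp(-z) = 1 is carried into A by
  \<open>\<iota>\<close>.\<close>

lemma character_eq_exp:
  fixes \<phi> :: "('k::finite \<Rightarrow> int) \<Rightarrow> 'a::comm_ring_1"
  assumes \<iota>: "C_algebra_hom \<iota>" and zero: "\<phi> 0 = 1"
    and plus: "\<And>\<alpha> \<beta>. \<phi> (\<alpha> + \<beta>) = \<phi> \<alpha> * \<phi> \<beta>"
    and gen: "\<And>i. \<phi> (alpha_gen i) = \<iota> (exp (z i))"
  shows "\<phi> \<alpha> = \<iota> (exp (\<Sum>i\<in>UNIV. z i * of_int (\<alpha> i)))"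
proof (induction \<alpha> rule: group_induct)
  case zero
  show ?case unfolding assms(2) by (simp add: C_algebra_hom_rules[OF \<iota>])
next
  case (plus \<alpha> i)
  then show ?case
    by (simp only: assms(3) gen sum_add_alpha_gen exp_add C_algebra_hom_rules[OF \<iota>])
next
  case (minus \<alpha> i)
  have inv: "\<iota> (exp (z i)) * \<iota> (exp (- z i)) = 1"
    by (simp add: C_algebra_hom_rules[OF \<iota>] flip: C_algebra_hom_rules(3)[OF \<iota>] exp_add)
  have "\<phi> (\<alpha> - alpha_gen i) = \<phi> (\<alpha> - alpha_gen i) * \<phi> (alpha_gen i) * \<iota> (exp (- z i))"
    by (simp add: gen mult.assoc inv)
  also have "\<dots> = \<phi> \<alpha> * \<iota> (exp (- z i))"
    by (simp flip: plus)
  also have "\<dots> = \<iota> (exp (\<Sum>j\<in>UNIV. z j * of_int ((\<alpha> - alpha_gen i) j)))"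
    unfolding minus sum_add_alpha_gen by (simp add: exp_diff exp_minus field_simps flip: C_algebra_hom_rules(3)[OF \<iota>])
  finally show ?case .
qed

text \<open>On grouplike elements such a functional is additive, hence fixed by the generators; at w
  x_m it equals \<open>counit w\<close> times its value at x_m. This expresses r(x_m \<otimes> .)
  and r(. \<otimes> x_m) through b, c and q.\<close>

lemma primitive_eq:
  fixes \<rho> :: "'k::finite bas \<Rightarrow> 'a::comm_ring_1"
  assumes plus: "\<And>u v. \<rho> (u + v) = \<rho> u * counit v + counit u * \<rho> v"
  shows "\<rho> u = (\<Sum>i\<in>UNIV. \<rho> (alpha_gen i, 0) * alpha_fun i u)
      + (\<Sum>n\<in>Poly_Mapping.keys (snd u). \<rho> (xgen n) * x_fun n u)"
proof (cases u rule: bas_cases)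
  case (group \<alpha>)
  have \<rho>_zero: "\<rho> (0, 0) = 0"
    using plus[of "(0, 0)" "(0, 0)"] by simp
  have add: "\<rho> (\<alpha> + \<beta>, 0) = \<rho> (\<alpha>, 0) + \<rho> (\<beta>, 0)" for \<alpha> \<beta>
    using plus[of "(\<alpha>, 0)" "(\<beta>, 0)"] by simp
  have "\<rho> (\<alpha>, 0) = (\<Sum>i\<in>UNIV. \<rho> (alpha_gen i, 0) * of_int (\<alpha> i))"
  proof (induction \<alpha> rule: group_induct)
    case zero
    show ?case unfolding \<rho>_zero by simp
  next
    case (plus \<alpha> i)
    then show ?case by (simp only: add sum_add_alpha_gen)
  next
    case (minus \<alpha> i)
    have "\<rho> (\<alpha> - alpha_gen i, 0) = \<rho> (\<alpha>, 0) - \<rho> (alpha_gen i, 0)"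
      using add[of "\<alpha> - alpha_gen i" "alpha_gen i"] unfolding diff_add_cancel by (simp only: eq_diff_eq)
    with minus show ?case by (simp only: sum_add_alpha_gen)
  qed
  then show ?thesis by (simp add: group alpha_fun_def)
next
  case (step w m)
  have "(\<Sum>n\<in>Poly_Mapping.keys (snd u). \<rho> (xgen n) * x_fun n u)
      = (\<Sum>n\<in>insert m (Poly_Mapping.keys (snd w)). if n = m then \<rho> (xgen m) * counit w else 0)"
    by (intro sum.cong) (auto simp: step keys_add_single_1 x_fun_add_xgen simp del: One_nat_def)
  also have "\<dots> = counit w * \<rho> (xgen m)"
    by (simp add: mult.commute del: sum.insert)
  finally show ?thesis by (simp add: step plus)
qed

subsection \<open>Translation of the Sweedler sums\<close>

lemma lookup_Delta_b:
  assumes "\<nu> \<in> divs (snd u)"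
  shows "Poly_Mapping.lookup (Delta_b u) ((fst u, \<nu>), (fst u, snd u - \<nu>)) = of_nat (mbinom (snd u) \<nu>)"
proof -
  have "Poly_Mapping.lookup (Delta_b u) ((fst u, \<nu>), (fst u, snd u - \<nu>))
     = (\<Sum>\<nu>'\<in>divs (snd u). if \<nu>' = \<nu> then of_nat (mbinom (snd u) \<nu>) else 0)"
    unfolding Delta_b_def case_prod_beta lookup_sum
    by (intro sum.cong) (auto simp: lookup_single when_def)
  then show ?thesis using assms by simp
qed

text \<open>Distinct divisors give distinct pairs, and their positive multiplicities are nonzero in
  the complex numbers, so no pair is lost from the support.\<close>

lemma keys_Delta_b:
  "Poly_Mapping.keys (Delta_b u) = (\<lambda>\<nu>. ((fst u, \<nu>), (fst u, snd u - \<nu>))) ` divs (snd u)"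
proof
  show "(\<lambda>\<nu>. ((fst u, \<nu>), (fst u, snd u - \<nu>))) ` divs (snd u) \<subseteq> Poly_Mapping.keys (Delta_b u)"
    using mbinom_pos by (fastforce simp: in_keys_iff lookup_Delta_b)
  show "Poly_Mapping.keys (Delta_b u) \<subseteq> (\<lambda>\<nu>. ((fst u, \<nu>), (fst u, snd u - \<nu>))) ` divs (snd u)"
  proof
    fix p assume "p \<in> Poly_Mapping.keys (Delta_b u)"
    then have "(\<Sum>\<nu>\<in>divs (snd u). Poly_Mapping.lookup (Poly_Mapping.single
        ((fst u, \<nu>), (fst u, snd u - \<nu>)) (of_nat (mbinom (snd u) \<nu>) :: complex)) p) \<noteq> 0"
      by (simp add: in_keys_iff Delta_b_def case_prod_beta lookup_sum)
    then obtain \<nu> where "\<nu> \<in> divs (snd u)" "Poly_Mapping.lookup (Poly_Mapping.single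
        ((fst u, \<nu>), (fst u, snd u - \<nu>)) (of_nat (mbinom (snd u) \<nu>) :: complex)) p \<noteq> 0"
      by (rule sum.not_neutral_contains_not_neutral)
    then show "p \<in> (\<lambda>\<nu>. ((fst u, \<nu>), (fst u, snd u - \<nu>))) ` divs (snd u)"
      by (auto simp: lookup_single when_def split: if_splits)
  qed
qed

text \<open>Bridge from sums over the support of \<open>Delta_b\<close> to \<open>cop_sum\<close>.
  The behaviour of \<open>G\<close> in the coefficient is prescribed on natural numbers only, as all
  coefficients are of this kind.\<close>

lemma sum_keys_Delta_b:
  assumes "\<And>n p. G (of_nat n) p = of_nat n * F (fst p) (snd p)"
  shows "(\<Sum>p\<in>Poly_Mapping.keys (Delta_b u). G (Poly_Mapping.lookup (Delta_b u) p) p) = cop_sum F u"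
proof -
  have "inj_on (\<lambda>\<nu>. ((fst u, \<nu>), (fst u, snd u - \<nu>))) (divs (snd u))"
    by (auto intro: inj_onI)
  then show ?thesis
    unfolding keys_Delta_b by (simp add: sum.reindex lookup_Delta_b assms cop_sum_def)
qed

context
  fixes \<iota> :: "complex \<Rightarrow> 'a::comm_ring_1"
  assumes \<iota>: "C_algebra_hom \<iota>"
begin

lemmas \<iota>_simps = C_algebra_hom_rules[OF \<iota>]

lemma rV_bv: "rV \<iota> r (bv u) (bv v) = r u v"
  by (simp add: rV_def bv_def \<iota>_simps)

lemma bicharacter_basis_bicharacter:
  assumes "bicharacter \<iota> r"
  shows "basis_bicharacter r"
proof
  have eta_bv: "\<iota> (eta (bv v)) = counit v" for v :: "'b bas"
    by (simp add: eta_def bv_def counit_def \<iota>_simps)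
  have Delta_bv: "Delta (bv w) = Delta_b w" for w :: "'b bas"
    by (simp add: Delta_def)
  fix u v w :: "'b bas"
  have "rV \<iota> r 1 (bv v) = \<iota> (eta (bv v))" "rV \<iota> r (bv v) 1 = \<iota> (eta (bv v))"
    using assms by (simp_all add: bicharacter_def)
  then show "r 0 v = counit v" "r v 0 = counit v"
    unfolding bv_zero[symmetric] rV_bv eta_bv by simp_all
  have "rV \<iota> r (bv u * bv v) (bv w) = (\<Sum>p\<in>Poly_Mapping.keys (Delta (bv w)).
      \<iota> (Poly_Mapping.lookup (Delta (bv w)) p) * rV \<iota> r (bv u) (bv (fst p)) * rV \<iota> r (bv v) (bv (snd p)))"
    using assms by (simp add: bicharacter_def)
  also have "\<dots> = cop_sum (\<lambda>a b. r u a * r v b) w"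
    unfolding Delta_bv rV_bv
    by (rule sum_keys_Delta_b[where G = "\<lambda>c p. \<iota> c * r u (fst p) * r v (snd p)"]) (simp add: \<iota>_simps mult.assoc)
  finally show "r (u + v) w = cop_sum (\<lambda>a b. r u a * r v b) w"
    unfolding bv_mult rV_bv .
  have "rV \<iota> r (bv w) (bv u * bv v) = (\<Sum>p\<in>Poly_Mapping.keys (Delta (bv w)).
      \<iota> (Poly_Mapping.lookup (Delta (bv w)) p) * rV \<iota> r (bv (fst p)) (bv u) * rV \<iota> r (bv (snd p)) (bv v))"
    using assms by (simp add: bicharacter_def)
  also have "\<dots> = cop_sum (\<lambda>a b. r a u * r b v) w"
    unfolding Delta_bv rV_bv
    by (rule sum_keys_Delta_b[where G = "\<lambda>c p. \<iota> c * r (fst p) u * r (snd p) v"]) (simp add: \<iota>_simps mult.assoc)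
  finally show "r w (u + v) = cop_sum (\<lambda>a b. r a u * r b v) w"
    unfolding bv_mult rV_bv .
qed

lemma sum_keys_Delta_b_smul:
  "(\<Sum>p\<in>Poly_Mapping.keys (Delta_b u). smul (\<iota> (x * Poly_Mapping.lookup (Delta_b u) p) * s p) (y p))
    = smul (\<iota> x) (cop_sum (\<lambda>a b. smul (s (a, b)) (y (a, b) :: 'k bas \<Rightarrow>\<^sub>0 'a)) u)"
proof -
  have "(\<Sum>p\<in>Poly_Mapping.keys (Delta_b u). smul (\<iota> (x * Poly_Mapping.lookup (Delta_b u) p) * s p) (y p))
    = cop_sum (\<lambda>a b. smul (\<iota> x) (smul (s (a, b)) (y (a, b)))) u"
    by (rule sum_keys_Delta_b[where G = "\<lambda>c p. smul (\<iota> (x * c) * s p) (y p)"])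
       (simp add: \<iota>_simps smul_smul mult_ac flip: smul_of_nat)
  then show ?thesis by (simp add: smul_cop_sum_right)
qed

lemma s_sym_eq_sym_fun: "s_sym \<iota> r u v = sym_fun r u v"
proof -
  have inner: "(\<Sum>p'\<in>Poly_Mapping.keys (Delta_b v).
      \<iota> (x * Poly_Mapping.lookup (Delta_b v) p') * r (fst p) (fst p') * r (snd p') (snd p))
      = \<iota> x * cop_sum (\<lambda>c d. r (fst p) c * r d (snd p)) v" for x p
    unfolding cop_sum_mult_left[symmetric]
    by (rule sum_keys_Delta_b[where G = "\<lambda>c p'. \<iota> (x * c) * r (fst p) (fst p') * r (snd p') (snd p)"])
       (simp add: \<iota>_simps mult_ac)
  show ?thesis
    unfolding s_sym_def sym_fun_def inner
    by (rule sum_keys_Delta_b[where G = "\<lambda>x p. \<iota> x * cop_sum (\<lambda>c d. r (fst p) c * r d (snd p)) v"])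
       (simp add: \<iota>_simps)
qed

section \<open>The product, EQ_r and the operator of R\<close>

lemma bullet_eq_lin_ext:
  "bullet \<iota> r f g = lin_ext (\<lambda>u. lin_ext (\<lambda>v.
     cop_sum (\<lambda>a b. cop_sum (\<lambda>c d. smul (sym_fun r b d) (bv (a + c))) v) u) g) f"
proof -
  have B: "(\<Sum>p\<in>Poly_Mapping.keys (Delta_b u). \<Sum>p'\<in>Poly_Mapping.keys (Delta_b v).
         smul (\<iota> (Poly_Mapping.lookup (Delta_b u) p * Poly_Mapping.lookup (Delta_b v) p') * sym_fun r (snd p) (snd p'))
              (bv (fst p + fst p')))
     = cop_sum (\<lambda>a b. cop_sum (\<lambda>c d. smul (sym_fun r b d) (bv (a + c))) v) u" for u v
    unfolding sum_keys_Delta_b_smul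
    by (rule sum_keys_Delta_b[where
        G = "\<lambda>x p. smul (\<iota> x) (cop_sum (\<lambda>c d. smul (sym_fun r (snd p) (snd (c, d))) (bv (fst p + fst (c, d)))) v)"])
       (simp add: \<iota>_simps smul_of_nat)
  show ?thesis
    unfolding bullet_def s_sym_eq_sym_fun B lin_ext_def smul_sum_right smul_smul ..
qed

lemma A_linear_bullet_left: "A_linear (\<lambda>f. bullet \<iota> r f g)"
  unfolding bullet_eq_lin_ext using A_linear_lin_ext .

lemma A_linear_bullet_right: "A_linear (\<lambda>g. bullet \<iota> r f g)"
  unfolding bullet_eq_lin_ext lin_ext_def[of _ f]
  by (intro A_linear_sum_fun A_linear_smul_fun A_linear_lin_ext)

lemma bullet_bv:
  "bullet \<iota> r (bv u) (bv v) = cop_sum (\<lambda>a b. cop_sum (\<lambda>c d. smul (sym_fun r b d) (bv (a + c))) v) u"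
  by (simp add: bullet_eq_lin_ext)

lemma conv_op_embA:
  "conv_op d (embA \<iota> v) = (\<Sum>u\<in>Poly_Mapping.keys v.
     smul (\<iota> (Poly_Mapping.lookup v u)) (cop_sum (\<lambda>a b. smul (d a) (bv b)) u))"
proof -
  have look: "Poly_Mapping.lookup (embA \<iota> v) u = \<iota> (Poly_Mapping.lookup v u)" for u
    by (simp add: embA_def Poly_Mapping.map.rep_eq when_def \<iota>_simps)
  have "Poly_Mapping.keys (embA \<iota> v) \<subseteq> Poly_Mapping.keys v"
    by (auto simp: in_keys_iff look \<iota>_simps)
  then show ?thesis
    unfolding conv_op_def by (subst lin_ext_eq_sum[of "Poly_Mapping.keys v"]) (auto simp: look)
qed

text \<open>With \<Delta>^2 formed as (\<Delta> \<otimes> id) \<Delta>, the inner sum over the left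
  leg is R of that leg.\<close>

lemma EQr_eq_conv_op: "EQr \<iota> r v = conv_op (cop_sum r) (embA \<iota> v)"
proof -
  have "(\<Sum>p\<in>Poly_Mapping.keys (Delta_b u). \<Sum>p'\<in>Poly_Mapping.keys (Delta_b (fst p)).
         smul (\<iota> (Poly_Mapping.lookup (Delta_b u) p * Poly_Mapping.lookup (Delta_b (fst p)) p') * r (fst p') (snd p'))
              (bv (snd p))) = cop_sum (\<lambda>a b. smul (cop_sum r a) (bv b)) u" for u
    unfolding sum_keys_Delta_b_smul
    by (rule sum_keys_Delta_b[where
        G = "\<lambda>x p. smul (\<iota> x) (cop_sum (\<lambda>c d. smul (r (fst (c, d)) (snd (c, d))) (bv (snd p))) (fst p))"])
       (simp add: \<iota>_simps smul_of_nat smul_cop_sum_left)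
  then show ?thesis by (simp add: EQr_def conv_op_embA)
qed

text \<open>On basis elements the multiplicativity of R gives the sum of R(u') R(v') s(u'' \<otimes>
  v'') u''' v'''. The product \<open>bullet\<close> has s on the last legs instead; coassociativity
  and cocommutativity exchange them.\<close>

lemma conv_op_diag_mult:
  fixes r :: "'k::finite bas \<Rightarrow> 'k bas \<Rightarrow> 'a"
  assumes "basis_bicharacter r"
  shows "conv_op (cop_sum r) (f * g) = bullet \<iota> r (conv_op (cop_sum r) f) (conv_op (cop_sum r) g)"
proof -
  interpret basis_bicharacter r by fact
  let ?R = "cop_sum r" and ?C = "conv_op (cop_sum r)" and ?S = "sym_fun r"
  have basis: "?C (bv u * bv v) = bullet \<iota> r (?C (bv u)) (?C (bv v))" for u v
  proof -
    define X where "X a s b c t d = smul (?R a * ?R c * ?S s t) (bv (b + d) :: 'k bas \<Rightarrow>\<^sub>0 'a)"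
      for a s b c t d
    have "?C (bv u * bv v) = cop_sum (\<lambda>a b. cop_sum (\<lambda>c d. smul (?R (a + c)) (bv (b + d))) v) u"
      unfolding bv_mult conv_op_bv by (rule cop_sum_plus)
    also have "\<dots> = cop_sum (\<lambda>a b. cop_sum (\<lambda>c d. cop_sum (\<lambda>a1 a2. cop_sum (\<lambda>c1 c2.
        X a1 a2 b c1 c2 d) c) a) v) u"
      unfolding cop_sum_diag_plus smul_cop_sum_left X_def ..
    also have "\<dots> = cop_sum (\<lambda>a b. cop_sum (\<lambda>a1 a2. cop_sum (\<lambda>c d. cop_sum (\<lambda>c1 c2.
        X a1 a2 b c1 c2 d) c) v) a) u"
      by (subst (2) cop_sum_commute) (rule refl)
    also have "\<dots> = cop_sum (\<lambda>a b. cop_sum (\<lambda>b1 b2. cop_sum (\<lambda>c d. cop_sum (\<lambda>c1 c2.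
        X a b1 b2 c1 c2 d) c) v) b) u"
      by (rule cop_sum_assoc)
    also have "\<dots> = cop_sum (\<lambda>a b. cop_sum (\<lambda>b1 b2. cop_sum (\<lambda>c d. cop_sum (\<lambda>d1 d2.
        X a b1 b2 c d1 d2) d) v) b) u"
      unfolding cop_sum_assoc ..
    \<comment> \<open>The exchange of the last two legs, for \<open>u\<close> and \<open>v\<close>
      separately.\<close>
    also have "\<dots> = cop_sum (\<lambda>a b. cop_sum (\<lambda>b1 b2. cop_sum (\<lambda>c d. cop_sum (\<lambda>d1 d2.
        X a b2 b1 c d2 d1) d) v) b) u"
    proof -
      have 1: "cop_sum (\<lambda>d1 d2. X a b1 b2 c d1 d2) d = cop_sum (\<lambda>d1 d2. X a b1 b2 c d2 d1) d" for a b1 b2 c d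
        by (rule cop_sum_flip)
      have 2: "cop_sum (\<lambda>b1 b2. cop_sum (\<lambda>c d. cop_sum (\<lambda>d1 d2. X a b1 b2 c d2 d1) d) v) b
         = cop_sum (\<lambda>b1 b2. cop_sum (\<lambda>c d. cop_sum (\<lambda>d1 d2. X a b2 b1 c d2 d1) d) v) b" for a b
        by (rule cop_sum_flip)
      show ?thesis
        by (subst 1) (rule arg_cong[where f = "\<lambda>F. cop_sum F u"], intro ext 2)
    qed
    also have "\<dots> = cop_sum (\<lambda>a b. cop_sum (\<lambda>c d. cop_sum (\<lambda>b1 b2. cop_sum (\<lambda>d1 d2.
        X a b2 b1 c d2 d1) d) b) v) u"
      by (subst (2) cop_sum_commute) (rule refl)
    also have "\<dots> = cop_sum (\<lambda>a b. cop_sum (\<lambda>c d. smul (?R a) (smul (?R c) (bullet \<iota> r (bv b) (bv d)))) v) u"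
      unfolding bullet_bv smul_cop_sum_right smul_smul X_def by (simp only: mult.assoc)
    also have "\<dots> = bullet \<iota> r (?C (bv u)) (?C (bv v))"
      unfolding conv_op_bv[of _ u] cop_sum_linear[OF A_linear_bullet_left] A_linear_smul[OF A_linear_bullet_left]
      unfolding conv_op_bv cop_sum_linear[OF A_linear_bullet_right] A_linear_smul[OF A_linear_bullet_right]
        smul_cop_sum_right ..
    finally show ?thesis .
  qed
  have left: "A_linear (\<lambda>f. ?C (f * g))" and right: "A_linear (\<lambda>g. ?C (f * g))" for f g
    by (auto intro!: A_linearI simp: distrib_left distrib_right smul_mult_left smul_mult_right
      A_linear_add[OF A_linear_conv_op] A_linear_smul[OF A_linear_conv_op])
  have "?C (bv u * g) = bullet \<iota> r (?C (bv u)) (?C g)" for u g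
    by (rule A_linear_eqI[OF right A_linear_comp[OF A_linear_bullet_right A_linear_conv_op]])
       (rule basis)
  then show ?thesis
    by (rule A_linear_eqI[OF left A_linear_comp[OF A_linear_bullet_left A_linear_conv_op]])
qed

lemma sum_list_xgen_varlist: "sum_list (map xgen (varlist \<mu>)) = (0, \<mu>)"
proof -
  have rep: "sum_list (map xgen (replicate n m)) = (0, Poly_Mapping.single m n)" for n m
    by (induction n) (auto simp: xgen_def zero_prod_def simp flip: single_add)
  have cc: "sum_list (map xgen (concat (map h ms))) = sum_list (map (\<lambda>m. sum_list (map xgen (h m))) ms)"
    for h :: "nat \<Rightarrow> nat list" and ms
    by (induction ms) simp_all
  have sm: "(\<Sum>m\<in>K. (0, Poly_Mapping.single m (Poly_Mapping.lookup \<mu> m))) =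
      (0, \<Sum>m\<in>K. Poly_Mapping.single m (Poly_Mapping.lookup \<mu> m))" if "finite K" for K
    using that by (induction K rule: finite_induct) (auto simp: zero_prod_def)
  have "(\<Sum>m\<in>Poly_Mapping.keys \<mu>. Poly_Mapping.single m (Poly_Mapping.lookup \<mu> m)) = \<mu>"
    by (rule poly_mapping_eqI) (auto simp: lookup_sum lookup_single when_def in_keys_iff)
  then show ?thesis
    unfolding varlist_def cc rep
    by (simp add: sum_list_distinct_conv_sum_set sm)
qed

text \<open>The operator of R is multiplicative into \<open>bullet\<close>, fixes x_m because R(x_m)
  = 0 and R(1) = 1, and scales e^\<alpha> by r(e^\<alpha> \<otimes> e^\<alpha>). So the nested
  products of \<open>bprod\<close> are images of ordinary products, which reassemble the
  monomial.\<close>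

lemma dot_eq_conv_op:
  assumes "basis_bicharacter r"
  shows "dot \<iota> r v = conv_op (cop_sum r) (embA \<iota> v)"
proof -
  interpret basis_bicharacter r by fact
  let ?C = "conv_op (cop_sum r)"
  have xvar: "xvar m = ?C (bv (xgen m))" for m
    by (simp add: conv_op_bv cop_sum_xgen[of "\<lambda>a b. smul (cop_sum r a) (bv b)"] xvar_def xgen_def[symmetric]
        zero_left del: One_nat_def)
  have bprod: "bprod \<iota> r ms = ?C (bv (sum_list (map xgen ms)))" for ms
  \<comment> \<open>\<open>bprod\<close> treats singletons apart, hence three cases.\<close>
  proof (induction ms rule: induct_list012)
    case 1
    show ?case by (simp add: conv_op_diag_one bv_zero)
  next
    case (2 m)
    show ?case by (simp add: xvar)
  next
    case (3 m n ms)
    then show ?case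
      by (simp add: xvar conv_op_diag_mult[OF assms, symmetric] bv_mult)
  qed
  have group: "Poly_Mapping.single (\<alpha>, 0) (r (\<alpha>, 0) (\<alpha>, 0)) = ?C (bv (\<alpha>, 0))" for \<alpha>
    by (simp add: conv_op_bv smul_bv)
  have "bullet \<iota> r (Poly_Mapping.single (fst u, 0) (r (fst u, 0) (fst u, 0))) (bprod \<iota> r (varlist (snd u)))
      = ?C (bv u)" for u
    unfolding bprod group conv_op_diag_mult[OF assms, symmetric] bv_mult sum_list_xgen_varlist by simp
  then have "dot \<iota> r v = (\<Sum>u\<in>Poly_Mapping.keys v. smul (\<iota> (Poly_Mapping.lookup v u)) (?C (bv u)))"
    by (simp add: dot_def)
  also have "\<dots> = ?C (embA \<iota> v)"
    unfolding conv_op_embA conv_op_bv ..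
  finally show ?thesis .
qed

text \<open>On grouplike elements r is a character in each argument: the right one is expanded with
  a generator on the left, and then the left one.\<close>

lemma diag_group_eq_exp:
  assumes "basis_bicharacter r"
    and a: "\<And>i j. r (alpha_gen i, 0) (alpha_gen j, 0) = \<iota> (exp (a i j))"
  shows "r (\<alpha>, 0) (\<alpha>, 0) = Qa_fun \<iota> a (\<alpha>, 0)"
proof -
  interpret basis_bicharacter r by fact
  have r0: "r (0, 0) (\<beta>, 0) = 1" "r (\<beta>, 0) (0, 0) = 1" for \<beta>
    using zero_left[of "(\<beta>, 0)"] zero_right[of "(\<beta>, 0)"] by (simp_all only: zero_prod_def counit_group)
  have "r (alpha_gen i, 0) (\<beta>, 0) = \<iota> (exp (\<Sum>j\<in>UNIV. a i j * of_int (\<beta> j)))" for i \<beta>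
    by (rule character_eq_exp[OF \<iota>, where \<phi> = "\<lambda>\<beta>. r (alpha_gen i, 0) (\<beta>, 0)"])
       (rule r0 group_right a)+
  then have "r (\<alpha>, 0) (\<alpha>, 0)
      = \<iota> (exp (\<Sum>i\<in>UNIV. (\<Sum>j\<in>UNIV. a i j * of_int (\<alpha> j)) * of_int (\<alpha> i)))"
    by (intro character_eq_exp[OF \<iota>, where \<phi> = "\<lambda>\<beta>. r (\<beta>, 0) (\<alpha>, 0)"] r0 group_left)
  then show ?thesis by (simp add: Qa_fun_def sum_distrib_left sum_distrib_right mult_ac)
qed

lemma expQ_eq_conv_op:
  assumes "basis_bicharacter r"
    and a: "\<And>i j. r (alpha_gen i, 0) (alpha_gen j, 0) = \<iota> (exp (a i j))"
    and b: "\<And>i m. b i m = r (alpha_gen i, 0) (xgen m)"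
    and c: "\<And>m i. c m i = r (xgen m) (alpha_gen i, 0)"
    and q: "\<And>m n. q m n = r (xgen m) (xgen n)"
  shows "expQ \<iota> a b c q = conv_op (cop_sum r)"
proof -
  interpret basis_bicharacter r by fact
  \<comment> \<open>The factors stand in the order in which the exponentials act.\<close>
  define F where "F = conv (conv (conv (cexp \<iota> (Qq_fun q)) (cexp \<iota> (Qb_fun (\<lambda>i m. c m i))))
      (cexp \<iota> (Qb_fun b))) (Qa_fun \<iota> a)"
  \<comment> \<open>The final 0 is the logarithmic derivative of \<open>Qa_fun\<close>, kept to
    match the shape produced by \<open>logderiv_conv\<close>.\<close>
  define g where "g m u = Qq_fun q (u + xgen m) + Qb_fun (\<lambda>i m. c m i) (u + xgen m)
      + Qb_fun b (u + xgen m) + 0" for m u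
  have "logderiv g F"
    unfolding g_def F_def
    by (intro logderiv_conv logderiv_cexp \<iota> logderiv_Qa_fun Qb_fun_group Qq_fun_group)
  moreover have "g = (\<lambda>m u. r u (xgen m) + r (xgen m) u)"
  proof (intro ext)
    fix m u
    have "r (xgen m) u = (\<Sum>i\<in>UNIV. c m i * alpha_fun i u)
        + (\<Sum>n\<in>Poly_Mapping.keys (snd u). q m n * x_fun n u)"
      unfolding c q by (rule primitive_eq) (rule primitive_left)
    moreover have "r u (xgen m) = (\<Sum>i\<in>UNIV. b i m * alpha_fun i u)
        + (\<Sum>n\<in>Poly_Mapping.keys (snd u). q n m * x_fun n u)"
      unfolding b q
      by (rule primitive_eq[where \<rho> = "\<lambda>u. r u (xgen m)"]) (rule primitive_right)
    \<comment> \<open>The b and c terms come from the two mixed summands; \<open>q m n\<close> and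
      \<open>q n m\<close> add up to the coefficient in \<open>Qq_fun_add_xgen\<close>.\<close>
    ultimately show "g m u = r u (xgen m) + r (xgen m) u"
      by (simp add: g_def Qq_fun_add_xgen Qb_fun_add_xgen distrib_right sum.distrib)
  qed
  ultimately have F: "logderiv (\<lambda>m u. r u (xgen m) + r (xgen m) u) F" by simp
  have "F = cop_sum r"
  proof
    fix u show "F u = cop_sum r u"
      by (rule logderiv_unique[OF F logderiv_diag])
         (simp add: F_def cexp_group[OF \<iota>] diag_group_eq_exp[OF assms(1) a])
  qed
  moreover have "expQ \<iota> a b c q f = conv_op F f" for f
    unfolding expQ_def Q_b_eq_conv_op Q_c_eq_conv_op Q_q_eq_conv_op exp_Qa_eq_conv_op F_def
    by (simp add: expop_conv_op conv_op_conv_op)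
  ultimately show ?thesis by auto
qed

end

theorem theorem4p7:
  fixes \<iota> :: "complex \<Rightarrow> 'a::comm_ring_1"
    and r :: "('k::finite) bas \<Rightarrow> 'k bas \<Rightarrow> 'a"
    and a :: "'k \<Rightarrow> 'k \<Rightarrow> complex"
    and b :: "'k \<Rightarrow> nat \<Rightarrow> 'a"
    and c :: "nat \<Rightarrow> 'k \<Rightarrow> 'a"
    and q :: "nat \<Rightarrow> nat \<Rightarrow> 'a"
  assumes "C_algebra_hom \<iota>"
    and "bicharacter \<iota> r"
    and "\<forall>\<alpha> \<beta>. \<exists>z. r (\<alpha>, 0) (\<beta>, 0) = \<iota> z"
    and "\<forall>i j. r (alpha_gen i, 0) (alpha_gen j, 0) = \<iota> (exp (a i j))"
    and "\<forall>i m. b i m = r (alpha_gen i, 0) (0, Poly_Mapping.single m 1)"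
    and "\<forall>m i. c m i = r (0, Poly_Mapping.single m 1) (alpha_gen i, 0)"
    and "\<forall>m n. q m n = r (0, Poly_Mapping.single m 1) (0, Poly_Mapping.single n 1)"
  shows "(\<forall>v. expQ \<iota> a b c q (embA \<iota> v) = EQr \<iota> r v \<and> expQ \<iota> a b c q (embA \<iota> v) = dot \<iota> r v)
    \<and> (\<forall>f g. expQ \<iota> a b c q (f * g) = bullet \<iota> r (expQ \<iota> a b c q f) (expQ \<iota> a b c q g))
    \<and> (\<forall>f g. expQ \<iota> a b c q (f + g) = expQ \<iota> a b c q f + expQ \<iota> a b c q g)
    \<and> (\<forall>s f. expQ \<iota> a b c q (smul s f) = smul s (expQ \<iota> a b c q f))
    \<and> expQ \<iota> a b c q 1 = 1"
proof -
  note \<iota> = assms(1)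
  have basis: "basis_bicharacter r"
    using bicharacter_basis_bicharacter[OF \<iota> assms(2)] .
  then interpret basis_bicharacter r .
  have expQ: "expQ \<iota> a b c q = conv_op (cop_sum r)"
    by (rule expQ_eq_conv_op[OF \<iota> basis]) (use assms(4-7) in \<open>simp_all only: xgen_def\<close>)
  show ?thesis
    unfolding expQ
    by (auto simp: conv_op_diag_one EQr_eq_conv_op[OF \<iota>] dot_eq_conv_op[OF \<iota> basis] conv_op_diag_mult[OF \<iota> basis]
        A_linear_add[OF A_linear_conv_op] A_linear_smul[OF A_linear_conv_op])
qed

end
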